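(* Let $A$ be a Nakayama algebra over a field $k$ and let $S_a$ be a simple $A$-module of infinite projective dimension. Suppose a minimal projective resolution of $S_a$ is periodic after $2r$, where $r\ge 0$ is an integer. Then $$\sum_{0\le i\le p-1}\dim_k\Omega^{2r+2i}(S_a)=n'_a,$$ where $p$ is the periodicity of the coresolution quiver $R^*_A$ and $n'_a$ is the number of vertices of the connected component of $R^*_A$ containing $a$.
   Context: Fix a field $k$; all modules are finite dimensional right modules. Let $\Delta_n$ ($n\ge 1$) be the cyclic quiver with vertices $1,\dots,n$ and arrows $x_a\colon a\to a+1$ for $1\le a\le n-1$ and $x_n\colon n\to 1$. A Nakayama algebra of order $n$ is a finite dimensional algebra $A$ isomorphic to the quotient of the path algebra $k\Delta_n$ by an ideal generated by a finite set of nontrivial paths (arrows are allowed in this set). For a vertex $a$, let $e_a$ be the idempotent, $S_a$ the simple module, $P_a=e_aA$ the indecomposable projective module and $I_a$ the indecomposable injective module (injective envelope of $S_a$) at $a$; paths are composed so that $e_aA$ is spanned by the paths starting at $a$. Put $q_a=\dim_k I_a$. Let $\tau(a)=a+1$ for $1\le a\le n-1$ and $\tau(n)=1$. The coresolution quiver $R^*_A$ has vertices $1,\dots,n$ and a unique arrow $a\to\psi(a)$ for each $a$, where $\psi(a)=\tau^{-q_a}(a)$. The periodicity of $R^*_A$ is the number of vertices on a cycle of $R^*_A$ (independent of the cycle chosen). $\Omega^i(M)$ denotes the $i$-th syzygy of $M$ in a minimal projective resolution ($\Omega^0(M)=M$). A minimal projective resolution of $S_a$ is periodic after $2r$ if there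 is $s\ge 1$ with $\Omega^{i+s}(S_a)\cong\Omega^i(S_a)$ for all $i\ge 2r$. *)

theory Defs
  imports
    "HOL-Algebra.Algebra"
    "HOL-Library.Extended_Nat"
    "HOL-Library.Function_Algebras"
begin

section \<open>Finite dimensional algebras over a field\<close>

text \<open>The ground field is a type \<open>'k :: field\<close>. An algebra is a HOL-Algebra ring (not necessarily
  commutative) together with the scalar multiplication of the record \<open>module\<close>; the
  library locale \<open>algebra\<close> is not applicable since it asks for a commutative ring.\<close>

locale fd_algebra = ring A for A :: "('k::field, 'a) module" (structure) +
  assumes smult_closed: "x \<in> carrier A \<Longrightarrow> c \<odot> x \<in> carrier A"
    and smult_distrib_left: "\<lbrakk>x \<in> carrier A; y \<in> carrier A\<rbrakk> \<Longrightarrow> c \<odot> (x \<oplus> y) = c \<odot> x \<oplus> c \<odot> y"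
    and smult_distrib_right: "x \<in> carrier A \<Longrightarrow> (c + d) \<odot> x = c \<odot> x \<oplus> d \<odot> x"
    and smult_smult: "x \<in> carrier A \<Longrightarrow> (c * d) \<odot> x = c \<odot> (d \<odot> x)"
    and smult_unit: "x \<in> carrier A \<Longrightarrow> 1 \<odot> x = x"
    and smult_mult_left: "\<lbrakk>x \<in> carrier A; y \<in> carrier A\<rbrakk> \<Longrightarrow> (c \<odot> x) \<otimes> y = c \<odot> (x \<otimes> y)"
    and smult_mult_right: "\<lbrakk>x \<in> carrier A; y \<in> carrier A\<rbrakk> \<Longrightarrow> x \<otimes> (c \<odot> y) = c \<odot> (x \<otimes> y)"
    and finitely_spanned: "\<exists>B. finite B \<and> B \<subseteq> carrier A \<and>
          (\<forall>x\<in>carrier A. \<exists>c. x = (\<Oplus>b\<in>B. c b \<odot> b))"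


section \<open>The path algebra of the cyclic quiver\<close>

definition rot :: "nat \<Rightarrow> nat \<Rightarrow> nat" where
  "rot n a = (if 1 \<le> a \<and> a < n then a + 1 else if a = n then 1 else a)"

lemma rot_vertex: "b \<in> {1..n} \<Longrightarrow> (rot n ^^ j) b \<in> {1..n}"
  by (induction j) (auto simp: rot_def)

lemma bij_rot: "1 \<le> n \<Longrightarrow> bij (rot n)"
proof -
  assume n: "1 \<le> n"
  have "\<And>y. \<exists>x. rot n x = y"
  proof -
    fix y show "\<exists>x. rot n x = y"
      by (rule exI[of _ "if y = 1 then n else if 1 < y \<and> y \<le> n then y - 1 else y"])
         (use n in \<open>simp add: rot_def; arith\<close>)
  qed
  then have "surj (rot n)" by (metis surjI)
  moreover have "inj (rot n)" using n by (auto simp: inj_def rot_def split: if_splits)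
  ultimately show ?thesis by (simp add: bij_def)
qed

text \<open>A path of the cyclic quiver with vertices \<open>1, \<dots>, n\<close> is determined by its starting vertex \<open>a\<close> and
  its length \<open>l\<close>; it is encoded as the pair \<open>(a, l)\<close>. It ends in \<open>(rot n ^^ l) a\<close>. The product of
  two paths is the left one followed by the right one, so that
  the product of \<open>(a, j)\<close> and \<open>(b, i)\<close> is \<open>(a, j + i)\<close> if \<open>b = (rot n ^^ j) a\<close> and zero otherwise.\<close>

definition paths :: "nat \<Rightarrow> (nat \<times> nat) set" where
  "paths n = {1..n} \<times> UNIV"

definition path_algebra :: "nat \<Rightarrow> ('k::field, nat \<times> nat \<Rightarrow> 'k) module" where
  "path_algebra n =
    \<lparr>carrier = {f. finite {p. f p \<noteq> 0} \<and> {p. f p \<noteq> 0} \<subseteq> paths n},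
     monoid.mult = (\<lambda>f g (a, l). \<Sum>j\<le>l. f (a, j) * g ((rot n ^^ j) a, l - j)),
     monoid.one = (\<lambda>(a, l). if a \<in> {1..n} \<and> l = 0 then 1 else 0),
     ring.zero = (\<lambda>_. 0),
     ring.add = (\<lambda>f g p. f p + g p),
     module.smult = (\<lambda>c f p. c * f p)\<rparr>"

definition path_elem :: "nat \<times> nat \<Rightarrow> (nat \<times> nat \<Rightarrow> 'k::field)" where
  "path_elem p = (\<lambda>r. if r = p then 1 else 0)"

lemma path_algebra_carrier_iff:
  "f \<in> carrier (path_algebra n) \<longleftrightarrow> finite {p. f p \<noteq> 0} \<and> (\<forall>a l. f (a, l) \<noteq> 0 \<longrightarrow> a \<in> {1..n})"
  by (auto simp: path_algebra_def paths_def)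

lemma path_mult_closed:
  assumes f: "f \<in> carrier (path_algebra n)" and g: "g \<in> carrier (path_algebra n)"
  shows "f \<otimes>\<^bsub>path_algebra n\<^esub> g \<in> carrier (path_algebra n)"
proof -
  let ?h = "f \<otimes>\<^bsub>path_algebra n\<^esub> g"
  let ?F = "{p. f p \<noteq> 0}" and ?G = "{p. g p \<noteq> 0}"
  have ex: "\<exists>j\<le>l. f (a, j) \<noteq> 0 \<and> g ((rot n ^^ j) a, l - j) \<noteq> 0" if "?h (a, l) \<noteq> 0" for a l
  proof (rule ccontr)
    assume "\<not> ?thesis"
    then have "?h (a, l) = 0"
      unfolding path_algebra_def by (auto intro!: sum.neutral)
    with that show False by simp
  qed
  have "{p. ?h p \<noteq> 0} \<subseteq> (\<lambda>(p, r). (fst p, snd p + snd r)) ` (?F \<times> ?G)"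
  proof
    fix p assume "p \<in> {p. ?h p \<noteq> 0}"
    then obtain a l where p: "p = (a, l)" and "?h (a, l) \<noteq> 0" by (cases p) auto
    with ex obtain j where "j \<le> l" "f (a, j) \<noteq> 0" "g ((rot n ^^ j) a, l - j) \<noteq> 0" by blast
    then show "p \<in> (\<lambda>(p, r). (fst p, snd p + snd r)) ` (?F \<times> ?G)"
      unfolding p by (intro image_eqI[of _ _ "((a, j), ((rot n ^^ j) a, l - j))"]) auto
  qed
  moreover have "finite (?F \<times> ?G)" using f g by (simp add: path_algebra_carrier_iff)
  ultimately have "finite {p. ?h p \<noteq> 0}" by (meson finite_imageI finite_subset)
  moreover have "a \<in> {1..n}" if "?h (a, l) \<noteq> 0" for a l
    using ex[OF that] f by (auto simp: path_algebra_carrier_iff)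
  ultimately show ?thesis by (simp add: path_algebra_carrier_iff)
qed

lemma path_mult_assoc:
  "(f \<otimes>\<^bsub>path_algebra n\<^esub> g) \<otimes>\<^bsub>path_algebra n\<^esub> h = f \<otimes>\<^bsub>path_algebra n\<^esub> (g \<otimes>\<^bsub>path_algebra n\<^esub> h)"
proof (rule ext, clarify)
  fix a l
  let ?t = "\<lambda>i j. f (a, i) * g ((rot n ^^ i) a, j - i) * h ((rot n ^^ j) a, l - j)"
  have "((f \<otimes>\<^bsub>path_algebra n\<^esub> g) \<otimes>\<^bsub>path_algebra n\<^esub> h) (a, l) = (\<Sum>j\<le>l. \<Sum>i\<le>j. ?t i j)"
    by (simp add: path_algebra_def sum_distrib_right)
  also have "\<dots> = (\<Sum>i\<le>l. \<Sum>j=i..l. ?t i j)"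
    by (subst sum.Sigma; simp?)+
       (rule sum.reindex_bij_witness[of _ "\<lambda>(i, j). (j, i)" "\<lambda>(i, j). (j, i)"]; auto)
  also have "\<dots> = (\<Sum>i\<le>l. \<Sum>m\<le>l - i. ?t i (m + i))"
  proof (rule sum.cong[OF refl])
    fix i assume "i \<in> {..l}"
    then show "(\<Sum>j=i..l. ?t i j) = (\<Sum>m\<le>l - i. ?t i (m + i))"
      by (intro sum.reindex_bij_witness[of _ "\<lambda>m. m + i" "\<lambda>j. j - i"]) auto
  qed
  also have "\<dots> = (f \<otimes>\<^bsub>path_algebra n\<^esub> (g \<otimes>\<^bsub>path_algebra n\<^esub> h)) (a, l)"
    by (simp add: path_algebra_def sum_distrib_left funpow_add mult.assoc) (simp add: add.commute)
  finally show "((f \<otimes>\<^bsub>path_algebra n\<^esub> g) \<otimes>\<^bsub>path_algebra n\<^esub> h) (a, l)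
    = (f \<otimes>\<^bsub>path_algebra n\<^esub> (g \<otimes>\<^bsub>path_algebra n\<^esub> h)) (a, l)" .
qed

lemma ring_path_algebra: "ring (path_algebra n :: ('k::field, _) module)"
proof (rule ringI)
  let ?R = "path_algebra n :: ('k::field, _) module"
  show "abelian_group ?R"
  proof (rule abelian_groupI)
    fix x y assume "x \<in> carrier ?R" "y \<in> carrier ?R"
    moreover have "{p. (x \<oplus>\<^bsub>?R\<^esub> y) p \<noteq> 0} \<subseteq> {p. x p \<noteq> 0} \<union> {p. y p \<noteq> 0}"
      by (auto simp: path_algebra_def)
    ultimately show "x \<oplus>\<^bsub>?R\<^esub> y \<in> carrier ?R"
      unfolding path_algebra_carrier_iff by (blast intro: finite_subset[OF _ finite_UnI])
  next
    fix x assume x: "x \<in> carrier ?R"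
    show "\<exists>y\<in>carrier ?R. y \<oplus>\<^bsub>?R\<^esub> x = \<zero>\<^bsub>?R\<^esub>"
      by (rule bexI[of _ "\<lambda>p. - x p"]) (use x in \<open>auto simp: path_algebra_def\<close>)
  qed (auto simp: path_algebra_def fun_eq_iff algebra_simps)
  show "Group.monoid ?R"
  proof (rule monoidI)
    have "{p. \<one>\<^bsub>?R\<^esub> p \<noteq> 0} \<subseteq> {1..n} \<times> {0}"
      by (auto simp: path_algebra_def split: if_splits)
    then show "\<one>\<^bsub>?R\<^esub> \<in> carrier ?R"
      unfolding path_algebra_carrier_iff
      by (auto intro: finite_subset)
  next
    fix x assume x: "x \<in> carrier ?R"
    show "\<one>\<^bsub>?R\<^esub> \<otimes>\<^bsub>?R\<^esub> x = x"
    proof (rule ext, clarify)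
      fix a l
      have "(\<one>\<^bsub>?R\<^esub> \<otimes>\<^bsub>?R\<^esub> x) (a, l) = (\<Sum>j\<in>{0}. (if a \<in> {1..n} \<and> j = 0 then 1 else 0) * x ((rot n ^^ j) a, l - j))"
        unfolding path_algebra_def monoid.simps prod.case by (rule sum.mono_neutral_right; auto)
      also have "\<dots> = x (a, l)" using x by (auto simp: path_algebra_carrier_iff)
      finally show "(\<one>\<^bsub>?R\<^esub> \<otimes>\<^bsub>?R\<^esub> x) (a, l) = x (a, l)" .
    qed
    show "x \<otimes>\<^bsub>?R\<^esub> \<one>\<^bsub>?R\<^esub> = x"
    proof (rule ext, clarify)
      fix a l
      have "(x \<otimes>\<^bsub>?R\<^esub> \<one>\<^bsub>?R\<^esub>) (a, l) = (\<Sum>j\<in>{l}. x (a, j) * (if (rot n ^^ j) a \<in> {1..n} \<and> l - j = 0 then 1 else 0))"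
        unfolding path_algebra_def monoid.simps prod.case by (rule sum.mono_neutral_right; auto)
      also have "\<dots> = x (a, l)" using x rot_vertex[of a n l] by (auto simp: path_algebra_carrier_iff)
      finally show "(x \<otimes>\<^bsub>?R\<^esub> \<one>\<^bsub>?R\<^esub>) (a, l) = x (a, l)" .
    qed
  qed (simp_all add: path_mult_closed path_mult_assoc)
qed (auto simp: path_algebra_def fun_eq_iff algebra_simps sum.distrib)

lemma path_elem_mult:
  "(path_elem (a, j) :: _ \<Rightarrow> 'k::field) \<otimes>\<^bsub>path_algebra n\<^esub> path_elem (b, i) =
     (if b = (rot n ^^ j) a then path_elem (a, j + i) else (\<lambda>_. 0))"
proof (rule ext, clarify)
  fix c l
  have "((path_elem (a, j) :: _ \<Rightarrow> 'k) \<otimes>\<^bsub>path_algebra n\<^esub> path_elem (b, i)) (c, l) =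
     (\<Sum>m\<le>l. if m = j then (if c = a \<and> (rot n ^^ j) a = b \<and> l - j = i then 1 else 0) else 0)"
    unfolding path_algebra_def path_elem_def monoid.simps prod.case by (rule sum.cong) auto
  also have "\<dots> = (if b = (rot n ^^ j) a then path_elem (a, j + i) else (\<lambda>_. 0)) (c, l)"
    by (auto simp: path_elem_def sum.delta)
  finally show "((path_elem (a, j) :: _ \<Rightarrow> 'k) \<otimes>\<^bsub>path_algebra n\<^esub> path_elem (b, i)) (c, l) =
    (if b = (rot n ^^ j) a then path_elem (a, j + i) else (\<lambda>_. 0)) (c, l)" .
qed

definition path_ideal :: "nat \<Rightarrow> (nat \<times> nat) set \<Rightarrow> (nat \<times> nat \<Rightarrow> 'k::field) set" where
  "path_ideal n \<rho> = genideal (path_algebra n) (path_elem ` \<rho>)"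

definition path_class :: "nat \<Rightarrow> (nat \<times> nat) set \<Rightarrow> (nat \<times> nat \<Rightarrow> 'k::field) \<Rightarrow> (nat \<times> nat \<Rightarrow> 'k) set" where
  "path_class n \<rho> f = path_ideal n \<rho> +>\<^bsub>path_algebra n\<^esub> f"


section \<open>Nakayama algebras\<close>

text \<open>\<open>A\<close> is identified, through the isomorphism \<open>\<phi>\<close> of algebras, with the quotient of the path algebra
  by the ideal generated by the finite set \<open>\<rho>\<close> of nontrivial paths. The quotient ring of the
  library carries no scalar multiplication, whence the separate linearity condition.\<close>

definition nakayama_algebra ::
  "nat \<Rightarrow> (nat \<times> nat) set \<Rightarrow> ((nat \<times> nat \<Rightarrow> 'k::field) set \<Rightarrow> 'a) \<Rightarrow> ('k, 'a) module \<Rightarrow> bool" where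
  "nakayama_algebra n \<rho> \<phi> A \<longleftrightarrow>
     1 \<le> n \<and> finite \<rho> \<and> \<rho> \<subseteq> paths n \<and> (\<forall>(a, l)\<in>\<rho>. 1 \<le> l) \<and>
     fd_algebra A \<and>
     \<phi> \<in> ring_iso (path_algebra n Quot path_ideal n \<rho>) A \<and>
     (\<forall>c. \<forall>f\<in>carrier (path_algebra n).
        \<phi> (path_class n \<rho> (c \<odot>\<^bsub>path_algebra n\<^esub> f)) = c \<odot>\<^bsub>A\<^esub> \<phi> (path_class n \<rho> f))"

definition vertex_idem ::
  "nat \<Rightarrow> (nat \<times> nat) set \<Rightarrow> ((nat \<times> nat \<Rightarrow> 'k::field) set \<Rightarrow> 'a) \<Rightarrow> nat \<Rightarrow> 'a" where
  "vertex_idem n \<rho> \<phi> a = \<phi> (path_class n \<rho> (path_elem (a, 0)))"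


section \<open>Finite dimensional right modules\<close>

text \<open>The underlying vector space of a finite dimensional module is taken to be a finite dimensional
  subspace of the space of all sequences in \<open>'k\<close>, with pointwise operations. Every finite dimensional
  module is isomorphic to one of this form, so quantifying over these modules amounts to quantifying
  over all finite dimensional modules.\<close>

definition vscale :: "'k::field \<Rightarrow> (nat \<Rightarrow> 'k) \<Rightarrow> (nat \<Rightarrow> 'k)" where
  "vscale c v = (\<lambda>i. c * v i)"

interpretation kvec: vector_space vscale
  by unfold_locales (auto simp: vscale_def fun_eq_iff algebra_simps)

record ('a, 'k) rmodule =
  space :: "(nat \<Rightarrow> 'k) set"
  act :: "(nat \<Rightarrow> 'k) \<Rightarrow> 'a \<Rightarrow> (nat \<Rightarrow> 'k)"

definition mdim :: "('a, 'k::field) rmodule \<Rightarrow> nat" where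
  "mdim M = kvec.dim (space M)"

definition right_module :: "('k::field, 'a) module \<Rightarrow> ('a, 'k) rmodule \<Rightarrow> bool" where
  "right_module A M \<longleftrightarrow>
     kvec.subspace (space M) \<and> (\<exists>B. finite B \<and> kvec.span B = space M) \<and>
     (\<forall>x\<in>space M. \<forall>r\<in>carrier A. act M x r \<in> space M) \<and>
     (\<forall>x\<in>space M. \<forall>y\<in>space M. \<forall>r\<in>carrier A. act M (x + y) r = act M x r + act M y r) \<and>
     (\<forall>x\<in>space M. \<forall>r\<in>carrier A. \<forall>s\<in>carrier A. act M x (r \<oplus>\<^bsub>A\<^esub> s) = act M x r + act M x s) \<and>
     (\<forall>x\<in>space M. \<forall>r\<in>carrier A. \<forall>s\<in>carrier A. act M x (r \<otimes>\<^bsub>A\<^esub> s) = act M (act M x r) s) \<and>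
     (\<forall>x\<in>space M. act M x \<one>\<^bsub>A\<^esub> = x) \<and>
     (\<forall>x\<in>space M. \<forall>r\<in>carrier A. \<forall>c. act M x (c \<odot>\<^bsub>A\<^esub> r) = vscale c (act M x r)) \<and>
     (\<forall>x\<in>space M. \<forall>r\<in>carrier A. \<forall>c. act M (vscale c x) r = vscale c (act M x r))"

text \<open>Homomorphisms are functions on the whole ambient type of which only the values on the source
  matter. Compatibility with the scalars \<open>c \<odot> \<one>\<close> makes them \<open>'k\<close>-linear.\<close>

definition is_hom ::
  "('k::field, 'a) module \<Rightarrow> ('a, 'k) rmodule \<Rightarrow> ('a, 'k) rmodule \<Rightarrow> ((nat \<Rightarrow> 'k) \<Rightarrow> (nat \<Rightarrow> 'k)) \<Rightarrow> bool" where
  "is_hom A M N f \<longleftrightarrow>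
     (\<forall>x\<in>space M. f x \<in> space N) \<and>
     (\<forall>x\<in>space M. \<forall>y\<in>space M. f (x + y) = f x + f y) \<and>
     (\<forall>x\<in>space M. \<forall>r\<in>carrier A. f (act M x r) = act N (f x) r)"

definition module_iso :: "('k::field, 'a) module \<Rightarrow> ('a, 'k) rmodule \<Rightarrow> ('a, 'k) rmodule \<Rightarrow> bool" where
  "module_iso A M N \<longleftrightarrow> (\<exists>f. is_hom A M N f \<and> bij_betw f (space M) (space N))"

definition is_epi where
  "is_epi A M N f \<longleftrightarrow> is_hom A M N f \<and> f ` space M = space N"

definition is_mono where
  "is_mono A M N f \<longleftrightarrow> is_hom A M N f \<and> inj_on f (space M)"

definition ker_space :: "('a, 'k::field) rmodule \<Rightarrow> ((nat \<Rightarrow> 'k) \<Rightarrow> (nat \<Rightarrow> 'k)) \<Rightarrow> (nat \<Rightarrow> 'k) set" where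
  "ker_space M f = {x\<in>space M. f x = 0}"

definition submodule :: "('k::field, 'a) module \<Rightarrow> ('a, 'k) rmodule \<Rightarrow> (nat \<Rightarrow> 'k) set \<Rightarrow> bool" where
  "submodule A M U \<longleftrightarrow> U \<subseteq> space M \<and> kvec.subspace U \<and> (\<forall>x\<in>U. \<forall>r\<in>carrier A. act M x r \<in> U)"

definition simple_module :: "('k::field, 'a) module \<Rightarrow> ('a, 'k) rmodule \<Rightarrow> bool" where
  "simple_module A M \<longleftrightarrow> right_module A M \<and> space M \<noteq> {0} \<and>
     (\<forall>U. submodule A M U \<longrightarrow> U = {0} \<or> U = space M)"

text \<open>The simple module at a vertex with idempotent \<open>e\<close>: the simple module, unique up to isomorphism,
  which is not annihilated by \<open>e\<close>.\<close>

definition simple_at :: "('k::field, 'a) module \<Rightarrow> 'a \<Rightarrow> ('a, 'k) rmodule \<Rightarrow> bool" where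
  "simple_at A e M \<longleftrightarrow> simple_module A M \<and> (\<exists>x\<in>space M. act M x e \<noteq> 0)"

definition projective :: "('k::field, 'a) module \<Rightarrow> ('a, 'k) rmodule \<Rightarrow> bool" where
  "projective A P \<longleftrightarrow> right_module A P \<and>
     (\<forall>M N g f. right_module A M \<and> right_module A N \<and> is_epi A M N g \<and> is_hom A P N f \<longrightarrow>
        (\<exists>h. is_hom A P M h \<and> (\<forall>x\<in>space P. g (h x) = f x)))"

definition injective :: "('k::field, 'a) module \<Rightarrow> ('a, 'k) rmodule \<Rightarrow> bool" where
  "injective A E \<longleftrightarrow> right_module A E \<and>
     (\<forall>M N g f. right_module A M \<and> right_module A N \<and> is_mono A M N g \<and> is_hom A M E f \<longrightarrow>
        (\<exists>h. is_hom A N E h \<and> (\<forall>x\<in>space M. h (g x) = f x)))"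

text \<open>Projective covers have a superfluous kernel, injective envelopes an essential image.\<close>

definition projective_cover where
  "projective_cover A P f M \<longleftrightarrow> projective A P \<and> is_epi A P M f \<and>
     (\<forall>U. submodule A P U \<and> {u + v |u v. u \<in> U \<and> v \<in> ker_space P f} = space P \<longrightarrow> U = space P)"

definition injective_envelope where
  "injective_envelope A E \<iota> M \<longleftrightarrow> injective A E \<and> is_mono A M E \<iota> \<and>
     (\<forall>U. submodule A E U \<and> U \<inter> \<iota> ` space M = {0} \<longrightarrow> U = {0})"


section \<open>Projective resolutions and syzygies\<close>

text \<open>For a sequence \<open>\<dots> \<rightarrow> P 1 \<rightarrow> P 0 \<rightarrow> M\<close> with maps \<open>d i\<close> starting in \<open>P i\<close>. In a projective resolution
  \<open>d i\<close> maps \<open>P i\<close> onto the \<open>i\<close>-th syzygy, which for \<open>i > 0\<close> is the kernel of \<open>d (i - 1)\<close>;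
  this is exactness. The resolution is minimal if these maps are projective covers.\<close>

fun syzygy ::
  "('a, 'k::field) rmodule \<Rightarrow> (nat \<Rightarrow> ('a, 'k) rmodule) \<Rightarrow> (nat \<Rightarrow> (nat \<Rightarrow> 'k) \<Rightarrow> (nat \<Rightarrow> 'k)) \<Rightarrow>
   nat \<Rightarrow> ('a, 'k) rmodule" where
  "syzygy M P d 0 = M"
| "syzygy M P d (Suc i) = (P i)\<lparr>space := ker_space (P i) (d i)\<rparr>"

definition projective_resolution where
  "projective_resolution A M P d \<longleftrightarrow> right_module A M \<and>
     (\<forall>i. projective A (P i) \<and> is_epi A (P i) (syzygy M P d i) (d i))"

definition minimal_projective_resolution where
  "minimal_projective_resolution A M P d \<longleftrightarrow> right_module A M \<and>
     (\<forall>i. projective_cover A (P i) (d i) (syzygy M P d i))"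

text \<open>For a nonzero module \<open>M\<close> this is the projective dimension; it is infinite iff there is no
  projective resolution of finite length.\<close>

definition proj_dim :: "('k::field, 'a) module \<Rightarrow> ('a, 'k) rmodule \<Rightarrow> enat" where
  "proj_dim A M = Inf {enat m |m. \<exists>P d. projective_resolution A M P d \<and> (\<forall>i>m. space (P i) = {0})}"

definition periodic_after ::
  "('k::field, 'a) module \<Rightarrow> (nat \<Rightarrow> ('a, 'k) rmodule) \<Rightarrow> nat \<Rightarrow> bool" where
  "periodic_after A \<Omega> m \<longleftrightarrow> (\<exists>s\<ge>1. \<forall>i\<ge>m. module_iso A (\<Omega> (i + s)) (\<Omega> i))"


section \<open>The coresolution quiver\<close>

text \<open>\<open>q\<close> is the function assigning to each vertex the dimension of its indecomposable injective.\<close>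

definition coresolution_map :: "nat \<Rightarrow> (nat \<Rightarrow> nat) \<Rightarrow> nat \<Rightarrow> nat" where
  "coresolution_map n q a = (inv_into UNIV (rot n) ^^ q a) a"

definition coresolution_arrows :: "nat \<Rightarrow> (nat \<Rightarrow> nat) \<Rightarrow> (nat \<times> nat) set" where
  "coresolution_arrows n q = {(a, coresolution_map n q a) |a. a \<in> {1..n}}"

text \<open>In a quiver with exactly one arrow leaving each vertex, the vertices of the cycle through \<open>b\<close>
  are the vertices reachable from \<open>b\<close>.\<close>

definition is_cycle :: "(nat \<times> nat) set \<Rightarrow> nat set \<Rightarrow> bool" where
  "is_cycle E C \<longleftrightarrow> (\<exists>b. (b, b) \<in> E\<^sup>+ \<and> C = {c. (b, c) \<in> E\<^sup>+})"

definition is_periodicity :: "(nat \<times> nat) set \<Rightarrow> nat \<Rightarrow> bool" where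
  "is_periodicity E p \<longleftrightarrow> (\<exists>C. is_cycle E C \<and> card C = p)"

definition component :: "(nat \<times> nat) set \<Rightarrow> nat \<Rightarrow> nat set" where
  "component E a = {c. (a, c) \<in> (E \<union> E\<inverse>)\<^sup>*}"

end

theory Submission
  imports Defs
begin

text \<open>Write the indecomposable modules as intervals \<open>[x, y)\<close> of integers, to be read modulo \<open>n\<close>: top at
  \<open>x\<close> and composition factors \<open>x, \<dots>, y - 1\<close>. With \<open>f x = x + dim P\<^sub>x\<close> the syzygy of \<open>[x, y)\<close> is
  \<open>[y, f x)\<close>, so \<open>\<Omega>\<^sup>2\<^sup>i S\<^sub>a\<close> is \<open>[f\<^sup>i a, f\<^sup>i (a + 1))\<close>. The lift \<open>g y = y - dim I\<^sub>y\<close> of \<open>\<psi>\<close> is the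
  upper adjoint of \<open>f\<close>, that is \<open>f x \<le> y \<longleftrightarrow> x \<le> g y\<close>; hence this interval is the fibre
  of \<open>g\<^sup>i\<close> over \<open>a\<close>, and \<open>dim \<Omega>\<^sup>2\<^sup>i S\<^sub>a\<close> is the number of vertices \<open>b\<close> with \<open>\<psi>\<^sup>i b = a\<close>.
  If the projective dimension is infinite, no fibre is empty and \<open>a\<close> lies on a cycle, whose length is
  \<open>p\<close> as \<open>g\<close> is monotone and commutes with the shift by \<open>n\<close>. Periodicity makes the fibres stabilise:
  those over \<open>p\<close> consecutive exponents are disjoint and cover the component of \<open>a\<close>.\<close>

section \<open>Lifting rotation-equivariant maps to the integers\<close>

text \<open>The adjunction comes from paths: the path from \<open>x\<close> to \<open>y\<close> is
  nonzero exactly if \<open>y < f x\<close>, and \<open>dim I\<close> at \<open>y\<close> counts the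
  nonzero paths ending there. As \<open>f\<close> is monotone, their starting points fill the
  integers after the largest \<open>x\<close> with \<open>f x \<le> y\<close>, up to
  \<open>y\<close>. However, \<open>f\<close> need not be injective: a collapse
  \<open>f\<^sup>i a = f\<^sup>i (a + 1)\<close> is a vanishing syzygy, which infinite projective
  dimension excludes. The obstacle lies on the module side. Simples, covers and envelopes are known
  only through their defining properties, and \<open>A\<close> only through \<open>\<phi>\<close>. A
  module is therefore pinned down by one vector whose path multiples form a basis, and
  \<open>dim I\<close> is squeezed between a bound from essentiality and one from injectivity,
  tested on an explicit module. Isomorphic syzygies give fibres of equal size, not equal fibres.
  What turns size into equality is that \<open>\<psi>\<^sup>p a = a\<close> nests the fibre at
  exponent \<open>i\<close> in the one at \<open>i + p\<close>.\<close>

lemma funpow_diff_apply: "j \<le> m \<Longrightarrow> (f ^^ (m - j)) ((f ^^ j) x) = (f ^^ m) x"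
  by (metis comp_apply funpow_add le_add_diff_inverse2)

text \<open>Vertices are numbered from 1, so the residue is taken of \<open>x - 1\<close> and
  shifted back; this makes \<open>vert n\<close> the identity on the vertices.\<close>

definition vert :: "nat \<Rightarrow> int \<Rightarrow> nat" where
  "vert n x = nat ((x - 1) mod int n) + 1"

lemma vert_in: "1 \<le> n \<Longrightarrow> vert n x \<in> {1..n}"
  using pos_mod_bound[of "int n" "x - 1"] pos_mod_sign[of "int n" "x - 1"] unfolding vert_def atLeastAtMost_iff by linarith

lemma vert_int: "b \<in> {1..n} \<Longrightarrow> vert n (int b) = b"
  by (auto simp: vert_def)

lemma vert_eq_iff: "1 \<le> n \<Longrightarrow> vert n x = vert n y \<longleftrightarrow> (\<exists>k. x = y + k * int n)"
proof -
  assume n: "1 \<le> n"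
  have "vert n x = vert n y \<longleftrightarrow> (x - 1) mod int n = (y - 1) mod int n"
    using n by (auto simp: vert_def eq_nat_nat_iff)
  also have "\<dots> \<longleftrightarrow> int n dvd x - y" by (simp add: mod_eq_dvd_iff)
  also have "\<dots> \<longleftrightarrow> (\<exists>k. x = y + k * int n)" by (auto simp: dvd_def algebra_simps)
  finally show ?thesis .
qed

lemma rot_vert: assumes n: "1 \<le> n" shows "rot n (vert n x) = vert n (x + 1)"
proof -
  let ?m = "(x - 1) mod int n"
  have m: "0 \<le> ?m" "?m < int n" using n by auto
  have "(x + 1 - 1) mod int n = (?m + 1) mod int n" by (simp add: mod_add_left_eq)
  also have "\<dots> = (if ?m + 1 = int n then 0 else ?m + 1)" using m by auto
  finally have e: "vert n (x + 1) = (if ?m + 1 = int n then 1 else nat (?m + 1) + 1)"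
    unfolding vert_def by auto
  show ?thesis
  proof (cases "?m + 1 = int n")
    case True
    then have "vert n x = n" unfolding vert_def using n by linarith
    then show ?thesis using e True n by (simp add: rot_def)
  next
    case False
    then have "vert n x < n" "1 \<le> vert n x" "nat (?m + 1) + 1 = vert n x + 1"
      unfolding vert_def using m by linarith+
    then show ?thesis using e False by (simp add: rot_def)
  qed
qed

lemma rot_pow_vert: "1 \<le> n \<Longrightarrow> (rot n ^^ j) (vert n x) = vert n (x + int j)"
  by (induction j) (auto simp: rot_vert algebra_simps)

lemma inv_rot_pow_vert:
  assumes "1 \<le> n" shows "(inv_into UNIV (rot n) ^^ j) (vert n x) = vert n (x - int j)"
proof (induction j)
  case (Suc j)
  have "inv_into UNIV (rot n) (vert n y) = vert n (y - 1)" for y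
    by (rule inv_f_eq) (use assms bij_rot[of n] rot_vert[of n "y - 1"] in \<open>auto simp: bij_def\<close>)
  then show ?case using Suc by (simp add: algebra_simps)
qed simp

section \<open>Monotone lifts of degree one that have a lower adjoint\<close>

locale adjoint_lift =
  fixes n :: nat and f g :: "int \<Rightarrow> int" and \<psi> :: "nat \<Rightarrow> nat"
  assumes n: "1 \<le> n"
    and adj: "f x \<le> y \<longleftrightarrow> x \<le> g y"
    and shift: "g (y + k * int n) = g y + k * int n"
    and lift: "vert n (g y) = \<psi> (vert n y)"
begin

lemma g_mono: "x \<le> y \<Longrightarrow> g x \<le> g y"
  using adj by (meson order.refl order_trans)

lemma adj_pow: "(f ^^ i) x \<le> y \<longleftrightarrow> x \<le> (g ^^ i) y"
  by (induction i arbitrary: x y) (simp_all add: adj funpow_swap1)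

lemma shift_pow: "(g ^^ i) (y + k * int n) = (g ^^ i) y + k * int n"
  by (induction i) (simp_all add: shift)

lemma mono_pow: "x \<le> y \<Longrightarrow> (g ^^ i) x \<le> (g ^^ i) y"
  by (induction i) (simp_all add: g_mono)

lemma lift_pow: "vert n ((g ^^ i) y) = (\<psi> ^^ i) (vert n y)"
  by (induction i) (simp_all add: lift)

text \<open>\<open>g\<^sup>i y = x\<close> says \<open>x \<le> g\<^sup>i y\<close> but not
  \<open>x + 1 \<le> g\<^sup>i y\<close>; the adjunction turns each of the two into a bound on
  \<open>y\<close>.\<close>

lemma fibre_pow: "{y. (g ^^ i) y = x} = {(f ^^ i) x ..< (f ^^ i) (x + 1)}"
proof -
  have *: "(g ^^ i) y = x \<longleftrightarrow> (f ^^ i) x \<le> y \<and> \<not> (f ^^ i) (x + 1) \<le> y" for y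
    unfolding adj_pow by linarith
  show ?thesis by (rule Set.set_eqI) (simp only: * mem_Collect_eq atLeastLessThan_iff not_le)
qed

text \<open>\<open>vert n\<close> maps the fibre of the lift over the single integer
  \<open>a\<close> bijectively onto the fibre of the power of \<psi>. Two preimages differing by
  \<open>k * n\<close> have images differing by \<open>k * n\<close>, so \<open>k = 0\<close>; a
  lift that lands on \<open>a + k * n\<close> is corrected by the same multiple.\<close>

lemma card_fibre:
  assumes a: "a \<in> {1..n}"
  shows "card {b \<in> {1..n}. (\<psi> ^^ i) b = a} = nat ((f ^^ i) (int a + 1) - (f ^^ i) (int a))"
proof -
  have "bij_betw (vert n) {y. (g ^^ i) y = int a} {b \<in> {1..n}. (\<psi> ^^ i) b = a}"
    unfolding bij_betw_def
  proof
    show "inj_on (vert n) {y. (g ^^ i) y = int a}"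
    proof (rule inj_onI)
      fix y z assume yz: "y \<in> {y. (g ^^ i) y = int a}" "z \<in> {y. (g ^^ i) y = int a}" "vert n y = vert n z"
      then obtain k where "y = z + k * int n" using vert_eq_iff[OF n] by blast
      with yz show "y = z" using shift_pow[of i z k] by simp
    qed
    show "vert n ` {y. (g ^^ i) y = int a} = {b \<in> {1..n}. (\<psi> ^^ i) b = a}"
    proof (intro equalityI subsetI)
      fix b assume "b \<in> vert n ` {y. (g ^^ i) y = int a}"
      then obtain y where "(g ^^ i) y = int a" "b = vert n y" by blast
      then show "b \<in> {b \<in> {1..n}. (\<psi> ^^ i) b = a}"
        using vert_in[OF n, of y] vert_int[OF a] lift_pow[of i y] by simp
    next
      fix b assume b: "b \<in> {b \<in> {1..n}. (\<psi> ^^ i) b = a}"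
      then have "vert n ((g ^^ i) (int b)) = vert n (int a)"
        using vert_int a by (simp add: lift_pow)
      then obtain k where k: "(g ^^ i) (int b) = int a + k * int n"
        using vert_eq_iff[OF n] by blast
      have "(g ^^ i) (int b + (- k) * int n) = int a" unfolding shift_pow k by simp
      moreover have "vert n (int b + (- k) * int n) = b"
        using vert_eq_iff[OF n] vert_int b by (metis (no_types, lifting) mem_Collect_eq)
      ultimately show "b \<in> vert n ` {y. (g ^^ i) y = int a}"
        by (intro image_eqI[of _ _ "int b + (- k) * int n"]) simp_all
    qed
  qed
  then have "card {b \<in> {1..n}. (\<psi> ^^ i) b = a} = card {y. (g ^^ i) y = int a}"
    by (simp add: bij_betw_same_card)
  then show ?thesis by (simp add: fibre_pow)
qed

text \<open>A monotone lift which fixes \<open>a\<close> keeps the orbit of a point in one fundamental domain \<open>[a, a + n]\<close>,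
  so that a periodic point has to be fixed by it.\<close>

lemma period_unique:
  assumes a: "a \<in> {1..n}" "(\<psi> ^^ m) a = a" and b: "b \<in> {1..n}" "(\<psi> ^^ m') b = b" "1 \<le> m'"
  shows "(\<psi> ^^ m) b = b"
proof -
  have "vert n ((g ^^ m) (int a)) = vert n (int a)" using a vert_int by (simp add: lift_pow)
  then obtain k where k: "(g ^^ m) (int a) = int a + k * int n" using vert_eq_iff[OF n] by blast
  \<comment> \<open>The \<open>k\<close> full turns are subtracted, so that the integer
    \<open>a\<close> becomes a genuine fixed point of \<open>h\<close>.\<close>
  define h where "h y = (g ^^ m) y - k * int n" for y
  \<comment> \<open>The representative of \<open>b\<close> in the fundamental domain that starts at
    \<open>a\<close>.\<close>
  define b' where "b' = int a + (int b - int a) mod int n"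
  have h_mono: "x \<le> y \<Longrightarrow> (h ^^ i) x \<le> (h ^^ i) y" for x y i
    by (induction i) (simp_all add: h_def mono_pow)
  have "h (int a + int n) = int a + int n"
    unfolding h_def using shift_pow[of m "int a" 1] k by simp
  then have ha: "(h ^^ i) (int a) = int a" "(h ^^ i) (int a + int n) = int a + int n" for i
    using k by (induction i) (simp_all add: h_def)
  have hv: "vert n (h y) = (\<psi> ^^ m) (vert n y)" for y
  proof -
    have "vert n (h y) = vert n ((g ^^ m) y)"
      unfolding h_def vert_eq_iff[OF n] by (rule exI[of _ "- k"]) simp
    then show ?thesis by (simp add: lift_pow)
  qed
  have b'v: "vert n b' = b"
  proof -
    have "b' = int b + (- ((int b - int a) div int n)) * int n"
      unfolding b'_def by (simp add: minus_div_mult_eq_mod[symmetric])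
    then show ?thesis using vert_eq_iff[OF n] vert_int[OF b(1)] by metis
  qed
  have b'r: "int a \<le> b'" "b' < int a + int n" unfolding b'_def using n by auto
  have hb: "h b' = b'"
  proof (cases "b' = int a")
    case True then show ?thesis using ha[of 1] by simp
  next
    case False
    have "vert n ((h ^^ i) b') = ((\<psi> ^^ m) ^^ i) b" for i
      by (induction i) (simp_all add: hv b'v)
    moreover have "((\<psi> ^^ m) ^^ m') b = b"
    proof -
      have "((\<psi> ^^ m') ^^ i) b = b" for i by (induction i) (simp_all add: b)
      then show ?thesis by (metis funpow_mult mult.commute)
    qed
    ultimately have "vert n ((h ^^ m') b') = vert n b'" using b'v by simp
    then obtain j where j: "(h ^^ m') b' = b' + j * int n" using vert_eq_iff[OF n] by blast
    have "int a \<le> (h ^^ m') b'" "(h ^^ m') b' \<le> int a + int n"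
      using h_mono[OF b'r(1), of m'] h_mono[of b' "int a + int n" m'] b'r ha by auto
    \<comment> \<open>Both points lie in \<open>[a, a + n]\<close> and \<open>b'\<close> is
      interior, so they differ by less than a full turn. For \<open>b' = a\<close> these bounds
      alone would allow exactly one turn, hence the separate case.\<close>
    then have "\<bar>j * int n\<bar> < int n" using j b'r False by linarith
    then have "j = 0" using n
      by (simp add: abs_mult)
    with j have fixed: "(h ^^ m') b' = b'" by simp
    obtain l where l: "m' = Suc l" using b(3) by (cases m') auto
    \<comment> \<open>A monotone map that moves \<open>b'\<close> keeps its later iterates on the
      same side of it, so the orbit could not return after \<open>m'\<close> steps.\<close>
    show ?thesis
    proof (rule antisym; rule ccontr)
      assume "\<not> h b' \<le> b'"
      then have lt: "b' < h b'" by simp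
      have "h b' \<le> (h ^^ Suc i) b'" for i
      proof (induction i)
        case (Suc i)
        have "b' \<le> (h ^^ Suc i) b'" using Suc lt by linarith
        from h_mono[OF this, of 1] show ?case by simp
      qed simp
      from this[of l] show False using fixed lt l by simp
    next
      assume "\<not> b' \<le> h b'"
      then have lt: "h b' < b'" by simp
      have "(h ^^ Suc i) b' \<le> h b'" for i
      proof (induction i)
        case (Suc i)
        have "(h ^^ Suc i) b' \<le> b'" using Suc lt by linarith
        from h_mono[OF this, of 1] show ?case by simp
      qed simp
      from this[of l] show False using fixed lt l by simp
    qed
  qed
  from hv[of b'] show ?thesis unfolding hb b'v by simp
qed

end

section \<open>Fibres of the powers of a self-map of a finite set\<close>

text \<open>The fibres over \<open>a\<close> grow along steps of \<open>p\<close>, because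
  \<open>\<psi> ^^ p\<close> fixes \<open>a\<close>, and from \<open>r\<close> on they have constant
  size along steps of \<open>s\<close>. Hence the fibre at \<open>i + s * p\<close> equals the one
  at \<open>i\<close>, and the fibre at \<open>i + p\<close> is caught between them. Minimality of
  \<open>p\<close> makes the fibres in a window of \<open>p\<close> exponents disjoint.\<close>

lemma sum_card_fibres:
  fixes \<psi> :: "'v \<Rightarrow> 'v"
  assumes V: "finite V"
    and p: "1 \<le> p" "(\<psi> ^^ p) a = a" "\<And>m. 0 < m \<Longrightarrow> m < p \<Longrightarrow> (\<psi> ^^ m) a \<noteq> a"
    and s: "1 \<le> s" "\<And>i. r \<le> i \<Longrightarrow> card {y \<in> V. (\<psi> ^^ (i + s)) y = a} = card {y \<in> V. (\<psi> ^^ i) y = a}"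
  shows "(\<Sum>i<p. card {y \<in> V. (\<psi> ^^ (r + i)) y = a}) = card {y \<in> V. \<exists>i. (\<psi> ^^ i) y = a}"
proof -
  define B where "B i = {y \<in> V. (\<psi> ^^ i) y = a}" for i
  have fin: "finite (B i)" for i using V by (simp add: B_def)
  have per: "(\<psi> ^^ (k * p)) a = a" for k
    by (induction k) (simp_all add: funpow_add p)
  have sub: "B i \<subseteq> B (i + k * p)" for i k
    unfolding B_def add.commute[of i] by (auto simp: funpow_add) (metis per)
  have "card (B (i + k * s)) = card (B i)" if "r \<le> i" for i k
  proof (induction k)
    case (Suc k)
    have "card (B ((i + k * s) + s)) = card (B (i + k * s))"
      unfolding B_def by (rule s(2)) (use that in simp)
    with Suc show ?case by (simp add: algebra_simps)
  qed simp
  \<comment> \<open>\<open>s * p\<close> is a multiple of both step lengths: \<open>p\<close> gives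
    the inclusion, \<open>s\<close> the equal size.\<close>
  then have eq: "B (i + s * p) = B i" if "r \<le> i" for i
    using card_subset_eq[OF fin sub[of i s]] that by (metis mult.commute)
  have step: "B (i + p) = B i" if "r \<le> i" for i
  proof
    obtain t where t: "s = Suc t" using s(1) by (cases s) auto
    have "B (i + p) \<subseteq> B ((i + p) + t * p)" by (rule sub)
    then show "B (i + p) \<subseteq> B i" using eq[OF that] t by (simp add: algebra_simps)
    show "B i \<subseteq> B (i + p)" using sub[of i 1] by simp
  qed
  have red: "B (r + (j + k * p)) = B (r + j)" for j k
  proof (induction k)
    case (Suc k)
    have "B ((r + (j + k * p)) + p) = B (r + (j + k * p))" by (rule step) simp
    with Suc show ?case by (simp add: algebra_simps)
  qed simp
  have "{y \<in> V. \<exists>i. (\<psi> ^^ i) y = a} = (\<Union>i<p. B (r + i))"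
  proof (intro equalityI subsetI)
    fix y assume "y \<in> {y \<in> V. \<exists>i. (\<psi> ^^ i) y = a}"
    then obtain i where y: "y \<in> B i" by (auto simp: B_def)
    \<comment> \<open>Adding \<open>r * p\<close> keeps the point in the fibre and raises the
      exponent to at least \<open>r\<close>, where reduction modulo \<open>p\<close> is
      available.\<close>
    with sub[of i r] have y': "y \<in> B (i + r * p)" by blast
    define j where "j = i + r * p - r"
    have j: "i + r * p = r + j" unfolding j_def using mult_le_mono2[OF p(1), of r] by linarith
    have "j = j mod p + j div p * p" by simp
    with red[of "j mod p" "j div p"] y' j have "y \<in> B (r + j mod p)" by simp
    moreover have "j mod p < p" using p(1) by simp
    ultimately show "y \<in> (\<Union>i<p. B (r + i))" by blast
  qed (auto simp: B_def)
  moreover have "card (\<Union>i<p. B (r + i)) = (\<Sum>i<p. card (B (r + i)))"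
  proof (rule card_UN_disjoint)
    have *: "B (r + i) \<inter> B (r + j) = {}" if "i < j" "j < p" for i j
    proof -
      have False if "y \<in> B (r + i)" "y \<in> B (r + j)" for y
      proof -
        have "(\<psi> ^^ (r + j)) y = (\<psi> ^^ (j - i)) ((\<psi> ^^ (r + i)) y)"
          using \<open>i < j\<close> funpow_diff_apply[of "r + i" "r + j" \<psi> y] by simp
        then have "(\<psi> ^^ (j - i)) a = a" using that by (simp add: B_def)
        moreover have "0 < j - i" "j - i < p" using \<open>i < j\<close> \<open>j < p\<close> by auto
        ultimately show False using p(3) by blast
      qed
      then show ?thesis by blast
    qed
    show "\<forall>i\<in>{..<p}. \<forall>j\<in>{..<p}. i \<noteq> j \<longrightarrow> B (r + i) \<inter> B (r + j) = {}"
      using * by (metis Int_commute lessThan_iff nat_neq_iff)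
  qed (use fin in auto)
  ultimately show ?thesis by (simp add: B_def)
qed

text \<open>A point \<open>b\<close> that reaches \<open>a\<close> after \<open>card V\<close> steps
  has \<open>card V + 1\<close> iterates on the way, so two of them coincide; from there on the
  orbit is periodic, and \<open>a\<close> is its last member.\<close>

lemma periodic_if_fibres_nonempty:
  fixes \<psi> :: "'v \<Rightarrow> 'v"
  assumes V: "finite V" "\<psi> ` V \<subseteq> V" and ne: "\<And>i. {y \<in> V. (\<psi> ^^ i) y = a} \<noteq> {}"
  shows "\<exists>m\<ge>1. (\<psi> ^^ m) a = a"
proof -
  let ?N = "card V"
  obtain b where b: "b \<in> V" "(\<psi> ^^ ?N) b = a" using ne by blast
  have "(\<psi> ^^ i) b \<in> V" for i by (induction i) (use b V in auto)
  then have "(\<lambda>i. (\<psi> ^^ i) b) ` {..?N} \<subseteq> V" by blast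
  then have "\<not> inj_on (\<lambda>i. (\<psi> ^^ i) b) {..?N}"
    using card_inj_on_le[OF _ _ V(1)] by fastforce
  then obtain i j where ij: "i < j" "j \<le> ?N" "(\<psi> ^^ i) b = (\<psi> ^^ j) b"
    unfolding inj_on_def by (metis atMost_iff nat_neq_iff)
  have "a = (\<psi> ^^ (?N - j)) ((\<psi> ^^ j) b)"
    using ij b by (simp add: funpow_diff_apply)
  also have "\<dots> = (\<psi> ^^ (?N - j)) ((\<psi> ^^ i) b)" using ij by simp
  finally have "(\<psi> ^^ (j - i)) a = (\<psi> ^^ (j - i + (?N - j) + i)) b"
    by (simp add: funpow_add)
  also have "j - i + (?N - j) + i = ?N" using ij by simp
  finally show ?thesis using b ij by (intro exI[of _ "j - i"]) auto
qed

section \<open>Cycles and components of the quiver of a self-map\<close>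

lemma funpow_arrows_trancl:
  assumes "\<psi> ` V \<subseteq> V"
  shows "(b, c) \<in> {(a, \<psi> a) |a. a \<in> V}\<^sup>+ \<longleftrightarrow> b \<in> V \<and> (\<exists>k\<ge>1. c = (\<psi> ^^ k) b)" (is "?l = ?r")
proof
  let ?E = "{(a, \<psi> a) |a. a \<in> V}"
  have pow: "b \<in> V \<Longrightarrow> (\<psi> ^^ i) b \<in> V" for i by (induction i) (use assms in auto)
  show "?r" if "?l"
    using that
  proof (induction rule: trancl_induct)
    case (base y) then show ?case by (auto intro!: exI[of _ 1])
  next
    case (step y z)
    then obtain k where "b \<in> V" "k \<ge> 1" "z = (\<psi> ^^ Suc k) b" by auto
    then show ?case by (intro conjI exI[of _ "Suc k"]) simp_all
  qed
  show "?l" if "?r"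
  proof -
    from that obtain k where k: "b \<in> V" "k \<ge> 1" "c = (\<psi> ^^ k) b" by blast
    have "(b, (\<psi> ^^ Suc i) b) \<in> ?E\<^sup>+" for i
    proof (induction i)
      case 0 then show ?case using k by auto
    next
      case (Suc i)
      have "((\<psi> ^^ Suc i) b, (\<psi> ^^ Suc (Suc i)) b) \<in> ?E" using pow[OF k(1), of "Suc i"] by auto
      with Suc show ?case by (rule trancl_into_trancl)
    qed
    from this[of "k - 1"] k show ?thesis by simp
  qed
qed

lemma card_orbit_period:
  assumes "(\<psi> ^^ m) b = b" "1 \<le> m" "\<And>i. 0 < i \<Longrightarrow> i < m \<Longrightarrow> (\<psi> ^^ i) b \<noteq> b"
  shows "card {c. \<exists>k\<ge>1. c = (\<psi> ^^ k) b} = m"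
proof -
  have per: "(\<psi> ^^ (i + k * m)) b = (\<psi> ^^ i) b" for i k
  proof -
    have "(\<psi> ^^ (k * m)) b = b" by (induction k) (simp_all add: funpow_add assms(1))
    then show ?thesis by (simp add: funpow_add)
  qed
  have "{c. \<exists>k\<ge>1. c = (\<psi> ^^ k) b} = (\<lambda>i. (\<psi> ^^ i) b) ` {..<m}"
  proof (intro equalityI subsetI)
    fix c assume "c \<in> {c. \<exists>k\<ge>1. c = (\<psi> ^^ k) b}"
    then obtain k where "c = (\<psi> ^^ k) b" by blast
    then have "c = (\<psi> ^^ (k mod m)) b" using per[of "k mod m" "k div m"] by simp
    then show "c \<in> (\<lambda>i. (\<psi> ^^ i) b) ` {..<m}" using assms(2) by auto
  next
    fix c assume "c \<in> (\<lambda>i. (\<psi> ^^ i) b) ` {..<m}"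
    then obtain i where "c = (\<psi> ^^ i) b" by blast
    then have "c = (\<psi> ^^ (i + 1 * m)) b" by (simp only: per)
    then show "c \<in> {c. \<exists>k\<ge>1. c = (\<psi> ^^ k) b}" using assms(2) by (intro CollectI exI[of _ "i + 1 * m"]) auto
  qed
  moreover have "inj_on (\<lambda>i. (\<psi> ^^ i) b) {..<m}"
  proof -
    have False if ij: "i < j" "j < m" and eq: "(\<psi> ^^ i) b = (\<psi> ^^ j) b" for i j
    proof -
      have "b = (\<psi> ^^ (m - j)) ((\<psi> ^^ j) b)"
        using ij assms(1) by (simp add: funpow_diff_apply)
      also have "\<dots> = (\<psi> ^^ (m - j + i)) b" unfolding eq[symmetric] by (simp add: funpow_add)
      finally show False using assms(3)[of "m - j + i"] ij by fastforce
    qed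
    then show ?thesis by (intro inj_onI) (metis lessThan_iff nat_neq_iff)
  qed
  ultimately show ?thesis by (simp add: card_image)
qed

text \<open>The points that eventually reach \<open>a\<close> are closed under arrows in both
  directions: backwards by lengthening the walk, forwards because \<open>a\<close> lies on a
  cycle.\<close>

lemma component_arrows:
  assumes V: "\<psi> ` V \<subseteq> V" and a: "a \<in> V" and p: "1 \<le> p" "(\<psi> ^^ p) a = a"
  shows "component {(a, \<psi> a) |a. a \<in> V} a = {y \<in> V. \<exists>i. (\<psi> ^^ i) y = a}"
proof (intro equalityI subsetI)
  let ?E = "{(a, \<psi> a) |a. a \<in> V}"
  fix y assume "y \<in> component ?E a"
  then have "(a, y) \<in> (?E \<union> ?E\<inverse>)\<^sup>*" by (simp add: component_def)
  then show "y \<in> {y \<in> V. \<exists>i. (\<psi> ^^ i) y = a}"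
  proof (induction rule: rtrancl_induct)
    case base show ?case using a by (auto intro!: exI[of _ 0])
  next
    case (step y z)
    then obtain i where y: "y \<in> V" "(\<psi> ^^ i) y = a" by blast
    from step(2) consider "z = \<psi> y" | "z \<in> V" "y = \<psi> z" by auto
    then show ?case
    proof cases
      case 1
      \<comment> \<open>An extra turn of the cycle keeps the exponent positive, so that one step can
        be removed even if \<open>i = 0\<close>.\<close>
      have "(\<psi> ^^ (i + p)) y = a" by (metis y(2) p(2) funpow_add comp_apply add.commute)
      moreover have "i + p = Suc (i + p - 1)" using p(1) by simp
      ultimately have "(\<psi> ^^ (i + p - 1)) z = a" by (metis 1 funpow_Suc_right comp_apply)
      then show ?thesis using 1 y V by blast
    next
      case 2
      then have "(\<psi> ^^ Suc i) z = a" using y by (simp only: funpow_Suc_right comp_apply)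
      then show ?thesis using 2 by blast
    qed
  qed
next
  let ?E = "{(a, \<psi> a) |a. a \<in> V}"
  fix y assume "y \<in> {y \<in> V. \<exists>i. (\<psi> ^^ i) y = a}"
  then obtain i where "y \<in> V" "(\<psi> ^^ i) y = a" by blast
  then have "(a, y) \<in> (?E \<union> ?E\<inverse>)\<^sup>*"
  proof (induction i arbitrary: y)
    case (Suc i)
    have "(\<psi> ^^ i) (\<psi> y) = a" using Suc.prems by (simp only: funpow_Suc_right comp_apply)
    with Suc V have "(a, \<psi> y) \<in> (?E \<union> ?E\<inverse>)\<^sup>*" by blast
    moreover have "(\<psi> y, y) \<in> ?E \<union> ?E\<inverse>" using Suc by blast
    ultimately show ?case by (rule rtrancl_into_rtrancl)
  qed simp
  then show "y \<in> component ?E a" by (simp add: component_def)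
qed

section \<open>Nakayama algebras as spans of nonzero paths\<close>

lemma path_algebra_simps:
  "\<zero>\<^bsub>path_algebra n\<^esub> = (\<lambda>_. 0)"
  "f \<oplus>\<^bsub>path_algebra n\<^esub> g = (\<lambda>p. f p + g p)"
  "c \<odot>\<^bsub>path_algebra n\<^esub> f = (\<lambda>p. c * f p)"
  "(f \<otimes>\<^bsub>path_algebra n\<^esub> g) (a, l) = (\<Sum>j\<le>l. f (a, j) * g ((rot n ^^ j) a, l - j))"
  by (simp_all add: path_algebra_def)

lemma path_elem_carrier: "p \<in> paths n \<Longrightarrow> path_elem p \<in> carrier (path_algebra n)"
proof -
  assume "p \<in> paths n"
  moreover have "{r. (path_elem p :: _ \<Rightarrow> 'a) r \<noteq> 0} = {p}" by (auto simp: path_elem_def)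
  ultimately show ?thesis unfolding path_algebra_def by simp
qed

lemma smult_carrier: "f \<in> carrier (path_algebra n) \<Longrightarrow> (\<lambda>p. c * f p) \<in> carrier (path_algebra n)"
  by (auto simp: path_algebra_carrier_iff elim: rev_finite_subset)

lemma add_carrier:
  "f \<in> carrier (path_algebra n) \<Longrightarrow> g \<in> carrier (path_algebra n) \<Longrightarrow>
    (\<lambda>p. f p + g p) \<in> carrier (path_algebra n)"
  using ring.ring_simprules(1)[OF ring_path_algebra, of f n g] by (simp add: path_algebra_simps)

lemma zero_carrier: "(\<lambda>_. 0) \<in> carrier (path_algebra n)"
  by (simp add: path_algebra_carrier_iff)

lemma path_algebra_minus:
  fixes f g :: "nat \<times> nat \<Rightarrow> 'k::field"
  assumes g: "g \<in> carrier (path_algebra n)"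
  shows "\<ominus>\<^bsub>path_algebra n\<^esub> g = (\<lambda>p. - 1 * g p)" "f \<ominus>\<^bsub>path_algebra n\<^esub> g = (\<lambda>p. f p - g p)"
proof -
  interpret R: ring "path_algebra n :: ('k, _) module" by (rule ring_path_algebra)
  have "(\<lambda>p. - 1 * g p) \<oplus>\<^bsub>path_algebra n\<^esub> g = \<zero>\<^bsub>path_algebra n\<^esub>" by (simp add: path_algebra_simps)
  then show "\<ominus>\<^bsub>path_algebra n\<^esub> g = (\<lambda>p. - 1 * g p)"
    by (rule R.minus_equality) (use g smult_carrier[of g n "- 1"] in auto)
  then show "f \<ominus>\<^bsub>path_algebra n\<^esub> g = (\<lambda>p. f p - g p)" by (simp add: a_minus_def path_algebra_simps)
qed

text \<open>The step case keeps \<open>f p \<noteq> 0\<close> for the fixed element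
  \<open>f\<close>, so that knowledge about the support of \<open>f\<close> is available for every
  path that is added.\<close>

lemma path_algebra_induct [consumes 1, case_names zero add]:
  assumes f: "f \<in> carrier (path_algebra n)"
    and zero: "P (\<lambda>_. 0)"
    and add: "\<And>c p g. p \<in> paths n \<Longrightarrow> f p \<noteq> 0 \<Longrightarrow> g \<in> carrier (path_algebra n) \<Longrightarrow> P g \<Longrightarrow>
      P (\<lambda>r. c * path_elem p r + g r)"
  shows "P f"
proof -
  let ?r = "\<lambda>S p. if p \<in> S then f p else 0"
  have fin: "finite {p. f p \<noteq> 0}" and sup: "{p. f p \<noteq> 0} \<subseteq> paths n"
    using f by (auto simp: path_algebra_def)
  have "P (?r S)" if "finite S" "S \<subseteq> {p. f p \<noteq> 0}" for S
    using that
  proof (induction S rule: finite_induct)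
    case empty show ?case using zero by simp
  next
    case (insert p S)
    have c: "?r S \<in> carrier (path_algebra n)"
    proof -
      have "{r. ?r S r \<noteq> 0} \<subseteq> {p. f p \<noteq> 0}" by auto
      with fin sup show ?thesis unfolding path_algebra_def by (auto elim: rev_finite_subset)
    qed
    have "P (\<lambda>r. f p * path_elem p r + ?r S r)"
      by (rule add) (use insert sup c in auto)
    also have "(\<lambda>r. f p * path_elem p r + ?r S r) = ?r (insert p S)"
      using insert(2) by (auto simp: path_elem_def fun_eq_iff)
    finally show ?case .
  qed
  from this[OF fin order.refl] have "P (?r {p. f p \<noteq> 0})" .
  moreover have "?r {p. f p \<noteq> 0} = f" by auto
  ultimately show ?thesis by (simp only:)
qed

section \<open>The monomial ideal generated by the relations\<close>

text \<open>The combinatorial criterion for a path to vanish in the quotient: it contains a relation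
  as a subpath, entered after \<open>j\<close> steps.\<close>

definition zero_path :: "nat \<Rightarrow> (nat \<times> nat) set \<Rightarrow> nat \<Rightarrow> nat \<Rightarrow> bool" where
  "zero_path n \<rho> a l \<longleftrightarrow> (\<exists>j i. j + i \<le> l \<and> ((rot n ^^ j) a, i) \<in> \<rho>)"

lemma zero_path_extend:
  assumes "zero_path n \<rho> ((rot n ^^ m) a) l" "m + l \<le> k" shows "zero_path n \<rho> a k"
proof -
  from assms(1) obtain j i where "j + i \<le> l" "((rot n ^^ j) ((rot n ^^ m) a), i) \<in> \<rho>"
    unfolding zero_path_def by blast
  then have "(j + m) + i \<le> k" "((rot n ^^ (j + m)) a, i) \<in> \<rho>"
    using assms(2) by (simp_all add: funpow_add)
  then show ?thesis unfolding zero_path_def by blast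
qed

lemma zero_path_mono: "zero_path n \<rho> a l \<Longrightarrow> l \<le> k \<Longrightarrow> zero_path n \<rho> a k"
  using zero_path_extend[of n \<rho> 0 a l k] by simp

text \<open>Combinations of zero paths form an ideal, since a zero path prolonged on either side
  stays zero; conversely each zero path is a product of a prefix, a relation and a suffix.\<close>

lemma path_ideal_eq:
  assumes \<rho>: "\<rho> \<subseteq> paths n"
  shows "path_ideal n \<rho> = {f \<in> carrier (path_algebra n :: ('k::field, _) module). \<forall>a l. f (a, l) \<noteq> 0 \<longrightarrow> zero_path n \<rho> a l}"
    (is "_ = ?J")
    and "ideal (path_ideal n \<rho>) (path_algebra n :: ('k, _) module)"
proof -
  let ?R = "path_algebra n :: ('k, _) module"
  interpret R: ring ?R by (rule ring_path_algebra)
  have nz: "\<exists>j\<le>l. f (a, j) \<noteq> 0 \<and> g ((rot n ^^ j) a, l - j) \<noteq> 0" if "(f \<otimes>\<^bsub>?R\<^esub> g) (a, l) \<noteq> 0" for f g a l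
  proof (rule ccontr)
    assume "\<not> ?thesis"
    then have "(f \<otimes>\<^bsub>?R\<^esub> g) (a, l) = 0" unfolding path_algebra_simps by (auto intro!: sum.neutral)
    with that show False by simp
  qed
  have gen: "path_elem ` \<rho> \<subseteq> carrier ?R" using \<rho> path_elem_carrier by blast
  show I: "ideal (path_ideal n \<rho>) ?R"
    unfolding path_ideal_def by (rule R.genideal_ideal[OF gen])
  then interpret I: ideal "path_ideal n \<rho>" ?R .
  have J: "ideal ?J ?R"
  proof (rule idealI[OF ring_path_algebra])
    show "subgroup ?J (add_monoid ?R)"
    proof (rule R.add.subgroupI)
      show "?J \<subseteq> carrier ?R" by auto
      show "?J \<noteq> {}" using R.zero_closed by (auto simp: path_algebra_simps(1))
      show "\<ominus>\<^bsub>?R\<^esub> f \<in> ?J" if "f \<in> ?J" for f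
      proof -
        have "\<ominus>\<^bsub>?R\<^esub> f = (\<lambda>p. - 1 * f p)" using that by (intro path_algebra_minus) auto
        then show ?thesis using that smult_carrier[of f n "- 1"] by auto
      qed
      show "f \<oplus>\<^bsub>?R\<^esub> g \<in> ?J" if "f \<in> ?J" "g \<in> ?J" for f g
        using that add_carrier[of f n g] unfolding path_algebra_simps by auto (metis add_0)
    qed
    fix f g assume f: "f \<in> ?J" and g: "g \<in> carrier ?R"
    show "g \<otimes>\<^bsub>?R\<^esub> f \<in> ?J"
    proof -
      have "zero_path n \<rho> a l" if fg: "(g \<otimes>\<^bsub>?R\<^esub> f) (a, l) \<noteq> 0" for a l
      proof -
        from nz[OF fg] obtain j where "j \<le> l" "zero_path n \<rho> ((rot n ^^ j) a) (l - j)" using f by auto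
        then show ?thesis using zero_path_extend[of n \<rho> j a "l - j" l] by simp
      qed
      then show ?thesis using f g by (auto intro: path_mult_closed)
    qed
    show "f \<otimes>\<^bsub>?R\<^esub> g \<in> ?J"
    proof -
      have "zero_path n \<rho> a l" if fg: "(f \<otimes>\<^bsub>?R\<^esub> g) (a, l) \<noteq> 0" for a l
      proof -
        from nz[OF fg] obtain j where "j \<le> l" "zero_path n \<rho> a j" using f by auto
        then show ?thesis by (rule_tac zero_path_mono)
      qed
      then show ?thesis using f g by (auto intro: path_mult_closed)
    qed
  qed
  show "path_ideal n \<rho> = ?J"
  proof
    have "path_elem ` \<rho> \<subseteq> ?J"
    proof
      fix f :: "nat \<times> nat \<Rightarrow> 'k" assume "f \<in> path_elem ` \<rho>"
      then obtain p where p: "p \<in> \<rho>" "f = path_elem p" by blast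
      have "zero_path n \<rho> a l" if "f (a, l) \<noteq> 0" for a l
      proof -
        have "p = (a, l)" using that p by (auto simp: path_elem_def split: if_splits)
        with p show ?thesis unfolding zero_path_def by (intro exI[of _ 0] exI[of _ l]) simp
      qed
      then show "f \<in> ?J" using p gen by auto
    qed
    then show "path_ideal n \<rho> \<subseteq> ?J"
      unfolding path_ideal_def by (rule R.genideal_minimal[OF J])
    show "?J \<subseteq> path_ideal n \<rho>"
    proof
      fix f :: "nat \<times> nat \<Rightarrow> 'k" assume "f \<in> ?J"
      then have f: "f \<in> carrier ?R" and z: "f (a, l) \<noteq> 0 \<Longrightarrow> zero_path n \<rho> a l" for a l by auto
      from f show "f \<in> path_ideal n \<rho>"
      proof (induction rule: path_algebra_induct)
        case zero show ?case using I.zero_closed by (simp add: path_algebra_simps)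
      next
        case (add c p g)
        obtain a l where p: "p = (a, l)" by (cases p)
        from z[of a l] add(2) p obtain j i where ji: "j + i \<le> l" "((rot n ^^ j) a, i) \<in> \<rho>"
          unfolding zero_path_def by blast
        let ?b = "(rot n ^^ j) a"
        have a: "a \<in> {1..n}" using add(1) p by (auto simp: paths_def)
        have k: "(path_elem (?b, i) :: _ \<Rightarrow> 'k) \<in> path_ideal n \<rho>"
          unfolding path_ideal_def by (rule subsetD[OF R.genideal_self[OF gen] imageI[OF ji(2)]])
        have v: "(b, m) \<in> paths n" if "b \<in> {1..n}" for b m using that by (auto simp: paths_def)
        let ?u = "(path_elem (a, j) :: _ \<Rightarrow> 'k) \<otimes>\<^bsub>?R\<^esub> path_elem (?b, i) \<otimes>\<^bsub>?R\<^esub> path_elem ((rot n ^^ (j + i)) a, l - (j + i))"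
        have u: "?u \<in> path_ideal n \<rho>"
          by (intro I.I_r_closed I.I_l_closed k path_elem_carrier v rot_vertex a)
        have "?u = path_elem p" using ji p by (simp add: path_elem_mult)
        \<comment> \<open>A ring ideal is closed under products only, so the scalar enters as left
          multiplication by \<open>c\<close> times the trivial path at \<open>a\<close>.\<close>
        moreover have "(\<lambda>r. c * path_elem (a, 0) r) \<otimes>\<^bsub>?R\<^esub> (path_elem p :: _ \<Rightarrow> 'k) \<in> path_ideal n \<rho>"
          using u unfolding \<open>?u = path_elem p\<close>
          by (intro I.I_l_closed smult_carrier path_elem_carrier v a)
        moreover have "(\<lambda>r. c * path_elem (a, 0) r) \<otimes>\<^bsub>?R\<^esub> path_elem p = (\<lambda>r. c * path_elem p r)"
        proof (rule ext, clarify)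
          fix b m
          have "((\<lambda>r. c * path_elem (a, 0) r) \<otimes>\<^bsub>?R\<^esub> path_elem p) (b, m) = c * ((path_elem (a, 0) \<otimes>\<^bsub>?R\<^esub> path_elem p) (b, m))"
            by (simp add: path_algebra_simps sum_distrib_left mult.assoc)
          then show "((\<lambda>r. c * path_elem (a, 0) r) \<otimes>\<^bsub>?R\<^esub> path_elem p) (b, m) = c * path_elem p (b, m)"
            by (simp add: p path_elem_mult)
        qed
        ultimately have "(\<lambda>r. c * path_elem p r) \<in> path_ideal n \<rho>" by simp
        from I.a_closed[OF this add(4)] show ?case by (simp add: path_algebra_simps)
      qed
    qed
  qed
qed

section \<open>Transport of the path calculus to \<open>A\<close>\<close>

locale nakayama =
  fixes n :: nat and \<rho> :: "(nat \<times> nat) set"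
    and \<phi> :: "(nat \<times> nat \<Rightarrow> 'k::field) set \<Rightarrow> 'a" and A :: "('k, 'a) module"
  assumes nak: "nakayama_algebra n \<rho> \<phi> A"
begin

abbreviation R :: "('k, nat \<times> nat \<Rightarrow> 'k) module" where "R \<equiv> path_algebra n"

definition cls :: "(nat \<times> nat \<Rightarrow> 'k) \<Rightarrow> 'a" where
  "cls f = \<phi> (path_class n \<rho> f)"

definition pth :: "nat \<Rightarrow> nat \<Rightarrow> 'a" where
  "pth a l = cls (path_elem (a, l))"

lemma n1: "1 \<le> n" and \<rho>_paths: "\<rho> \<subseteq> paths n"
  and iso: "\<phi> \<in> ring_iso (R Quot path_ideal n \<rho>) A"
  and cls_smult: "f \<in> carrier R \<Longrightarrow> cls (\<lambda>p. c * f p) = c \<odot>\<^bsub>A\<^esub> cls f"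
  using nak unfolding nakayama_algebra_def cls_def by (auto simp: path_algebra_simps)

sublocale A: fd_algebra A
  using nak by (simp add: nakayama_algebra_def)

lemma cls_hom: "cls \<in> ring_hom R A"
proof -
  have "(+>\<^bsub>R\<^esub>) (path_ideal n \<rho>) \<in> ring_hom R (R Quot path_ideal n \<rho>)"
    by (rule ideal.rcos_ring_hom[OF path_ideal_eq(2)[OF \<rho>_paths]])
  then have "\<phi> \<circ> (+>\<^bsub>R\<^esub>) (path_ideal n \<rho>) \<in> ring_hom R A"
    using iso by (auto simp: ring_iso_def intro: ring_hom_trans)
  moreover have "\<phi> \<circ> (+>\<^bsub>R\<^esub>) (path_ideal n \<rho>) = cls" by (simp add: cls_def path_class_def fun_eq_iff)
  ultimately show ?thesis by simp
qed

lemma cls_closed: "f \<in> carrier R \<Longrightarrow> cls f \<in> carrier A"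
  using ring_hom_memE(1)[OF cls_hom] .

lemma cls_mult: "f \<in> carrier R \<Longrightarrow> g \<in> carrier R \<Longrightarrow> cls (f \<otimes>\<^bsub>R\<^esub> g) = cls f \<otimes>\<^bsub>A\<^esub> cls g"
  using ring_hom_memE(2)[OF cls_hom] .

lemma cls_add: "f \<in> carrier R \<Longrightarrow> g \<in> carrier R \<Longrightarrow> cls (\<lambda>p. f p + g p) = cls f \<oplus>\<^bsub>A\<^esub> cls g"
  using ring_hom_memE(3)[OF cls_hom] by (simp add: path_algebra_simps)

lemma cls_one: "cls \<one>\<^bsub>R\<^esub> = \<one>\<^bsub>A\<^esub>"
  using ring_hom_memE(4)[OF cls_hom] .

lemma cls_surj: "r \<in> carrier A \<Longrightarrow> \<exists>f\<in>carrier R. cls f = r"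
proof -
  assume "r \<in> carrier A"
  then have "r \<in> \<phi> ` carrier (R Quot path_ideal n \<rho>)"
    using iso by (simp add: ring_iso_def bij_betw_def)
  also have "carrier (R Quot path_ideal n \<rho>) = path_class n \<rho> ` carrier R"
    unfolding FactRing_def A_RCOSETS_def' path_class_def by auto
  finally show ?thesis by (auto simp: cls_def)
qed

text \<open>The difference of two representatives lies in the ideal, hence is supported on zero
  paths: the nonzero paths give a basis of \<open>A\<close>.\<close>

lemma cls_eq_iff:
  assumes f: "f \<in> carrier R" and g: "g \<in> carrier R"
  shows "cls f = cls g \<longleftrightarrow> (\<forall>a l. \<not> zero_path n \<rho> a l \<longrightarrow> f (a, l) = g (a, l))"
proof -
  interpret R: ring R by (rule ring_path_algebra)
  note I = path_ideal_eq(2)[OF \<rho>_paths]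
  have c: "path_class n \<rho> h \<in> carrier (R Quot path_ideal n \<rho>)" if "h \<in> carrier R" for h
    using that by (auto simp: FactRing_def A_RCOSETS_def' path_class_def)
  have "cls f = cls g \<longleftrightarrow> path_class n \<rho> f = path_class n \<rho> g"
    unfolding cls_def using iso c[OF f] c[OF g] by (auto simp: ring_iso_def bij_betw_def inj_on_def)
  also have "\<dots> \<longleftrightarrow> f \<ominus>\<^bsub>R\<^esub> g \<in> path_ideal n \<rho>"
    unfolding path_class_def using R.quotient_eq_iff_same_a_r_cos[OF I f g] by simp
  also have "f \<ominus>\<^bsub>R\<^esub> g = (\<lambda>p. f p - g p)"
    by (rule path_algebra_minus(2)[OF g])
  also have "(\<lambda>p. f p - g p) \<in> path_ideal n \<rho> \<longleftrightarrow> (\<forall>a l. \<not> zero_path n \<rho> a l \<longrightarrow> f (a, l) = g (a, l))"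
    using add_carrier[OF f smult_carrier[OF g, of "- 1"]] unfolding path_ideal_eq(1)[OF \<rho>_paths] by auto
  finally show ?thesis .
qed

lemma cls_zero: "cls (\<lambda>_. 0) = \<zero>\<^bsub>A\<^esub>"
proof -
  have "cls (\<lambda>_. 0) \<oplus>\<^bsub>A\<^esub> cls (\<lambda>_. 0) = cls (\<lambda>_. 0)"
    using cls_add[OF zero_carrier zero_carrier] by simp
  moreover have "cls (\<lambda>_. 0) \<in> carrier A"
    by (intro cls_closed zero_carrier)
  ultimately show ?thesis using A.add.l_cancel_one by metis
qed

lemma path_elem_R: "a \<in> {1..n} \<Longrightarrow> path_elem (a, l) \<in> carrier R"
  by (rule path_elem_carrier) (auto simp: paths_def)

lemma pth_closed: "a \<in> {1..n} \<Longrightarrow> pth a l \<in> carrier A"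
  unfolding pth_def by (intro cls_closed path_elem_R)

lemma pth_mult:
  "a \<in> {1..n} \<Longrightarrow> b \<in> {1..n} \<Longrightarrow>
    pth a j \<otimes>\<^bsub>A\<^esub> pth b i = (if b = (rot n ^^ j) a then pth a (j + i) else \<zero>\<^bsub>A\<^esub>)"
  using cls_mult[OF path_elem_R[of a j] path_elem_R[of b i]]
  by (simp add: pth_def path_elem_mult cls_zero split: if_splits)

lemma pth_zero_iff: "a \<in> {1..n} \<Longrightarrow> pth a l = \<zero>\<^bsub>A\<^esub> \<longleftrightarrow> zero_path n \<rho> a l"
proof -
  assume a: "a \<in> {1..n}"
  show ?thesis unfolding pth_def cls_zero[symmetric] cls_eq_iff[OF path_elem_R[OF a] zero_carrier]
    by (auto simp: path_elem_def)
qed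

text \<open>Through this rule homomorphisms and submodules need to be checked on paths only.\<close>

lemma algebra_induct [consumes 1, case_names zero add smult pth]:
  assumes r: "r \<in> carrier A"
    and zero: "P \<zero>\<^bsub>A\<^esub>"
    and add: "\<And>r s. r \<in> carrier A \<Longrightarrow> s \<in> carrier A \<Longrightarrow> P r \<Longrightarrow> P s \<Longrightarrow> P (r \<oplus>\<^bsub>A\<^esub> s)"
    and smult: "\<And>c r. r \<in> carrier A \<Longrightarrow> P r \<Longrightarrow> P (c \<odot>\<^bsub>A\<^esub> r)"
    and pth: "\<And>a l. a \<in> {1..n} \<Longrightarrow> P (pth a l)"
  shows "P r"
proof -
  obtain f where f: "f \<in> carrier R" "r = cls f" using cls_surj[OF r] by auto
  from f(1) have "P (cls f)"
  proof (induction rule: path_algebra_induct)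
    case zero show ?case using assms(2) by (simp add: cls_zero)
  next
    case (add c p g)
    obtain a l where p: "p = (a, l)" "a \<in> {1..n}" using add(1) by (auto simp: paths_def)
    have "cls (\<lambda>r. c * path_elem p r + g r) = c \<odot>\<^bsub>A\<^esub> pth a l \<oplus>\<^bsub>A\<^esub> cls g"
      using cls_add[OF smult_carrier[OF path_elem_R[OF p(2)]] add(3)] cls_smult[OF path_elem_R[OF p(2)]]
      by (simp add: p pth_def)
    then show ?case
      using add p by (auto intro!: assms(3-5) A.smult_closed pth_closed cls_closed)
  qed
  then show ?thesis by (simp add: f)
qed

text \<open>Finite dimension bounds the path length. The finitely many spanning elements have
  representatives of finite support; choose \<open>M\<close> beyond all these supports at
  \<open>a\<close>. A nonzero path \<open>(a, M)\<close> would have coefficient 1 at itself, whereas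
  every combination of the representatives has coefficient 0 there.\<close>

lemma zero_path_exists: assumes a: "a \<in> {1..n}" shows "\<exists>l. zero_path n \<rho> a l"
proof -
  obtain B where B: "finite B" "B \<subseteq> carrier A" "\<And>x. x \<in> carrier A \<Longrightarrow> \<exists>c. x = (\<Oplus>\<^bsub>A\<^esub>b\<in>B. c b \<odot>\<^bsub>A\<^esub> b)"
    using A.finitely_spanned by blast
  have "\<exists>f L. f \<in> carrier R \<and> cls f = b \<and> (\<forall>l\<ge>L. f (a, l) = 0)" if "b \<in> B" for b
  proof -
    obtain f where f: "f \<in> carrier R" "cls f = b" using cls_surj B(2) \<open>b \<in> B\<close> by blast
    then have "finite {p. f p \<noteq> 0}" by (simp add: path_algebra_carrier_iff)
    then have "finite (snd ` {p. f p \<noteq> 0})" by simp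
    then obtain L where L: "\<forall>l\<in>snd ` {p. f p \<noteq> 0}. l < L" using finite_nat_set_iff_bounded by blast
    have "f (a, l) = 0" if "l \<ge> L" for l
      using L that by (force simp: image_iff)
    with f show ?thesis by blast
  qed
  then obtain F L where FL: "\<And>b. b \<in> B \<Longrightarrow> F b \<in> carrier R \<and> cls (F b) = b \<and> (\<forall>l\<ge>L b. F b (a, l) = 0)"
    by metis
  define M where "M = Max (insert 0 (L ` B))"
  have M: "F b (a, M) = 0" if "b \<in> B" for b
    using FL[OF that] Max_ge[of "insert 0 (L ` B)" "L b"] that B(1) by (auto simp: M_def)
  obtain c where c: "pth a M = (\<Oplus>\<^bsub>A\<^esub>b\<in>B. c b \<odot>\<^bsub>A\<^esub> b)"
    using B(3)[OF pth_closed[OF a]] by blast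
  have sum: "(\<lambda>p. \<Sum>b\<in>S. c b * F b p) \<in> carrier R \<and> cls (\<lambda>p. \<Sum>b\<in>S. c b * F b p) = (\<Oplus>\<^bsub>A\<^esub>b\<in>S. c b \<odot>\<^bsub>A\<^esub> b)"
    if "S \<subseteq> B" for S
    using finite_subset[OF that B(1)] that
  proof (induction S rule: finite_induct)
    case empty then show ?case using zero_carrier by (simp add: cls_zero)
  next
    case (insert b S)
    have b: "F b \<in> carrier R" "cls (F b) = b" using FL insert by auto
    have cl: "(\<lambda>b. c b \<odot>\<^bsub>A\<^esub> b) \<in> S \<rightarrow> carrier A" "c b \<odot>\<^bsub>A\<^esub> b \<in> carrier A"
      using insert B(2) by (auto intro!: A.smult_closed)
    show ?case
      using insert add_carrier[OF smult_carrier[OF b(1), of "c b"], of "\<lambda>p. \<Sum>b\<in>S. c b * F b p"]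
        cls_add[OF smult_carrier[OF b(1), of "c b"], of "\<lambda>p. \<Sum>b\<in>S. c b * F b p"] cls_smult[OF b(1), of "c b"] cl
      by (simp add: A.finsum_insert b(2))
  qed
  have "zero_path n \<rho> a M"
  proof (rule ccontr)
    assume nz: "\<not> zero_path n \<rho> a M"
    have "cls (path_elem (a, M)) = cls (\<lambda>p. \<Sum>b\<in>B. c b * F b p)"
      using sum[of B] c by (simp add: pth_def)
    then have "(path_elem (a, M) :: _ \<Rightarrow> 'k) (a, M) = (\<Sum>b\<in>B. c b * F b (a, M))"
      using cls_eq_iff[OF path_elem_R[OF a]] sum[of B] nz by blast
    then show False using M by (simp add: path_elem_def)
  qed
  then show ?thesis ..
qed

text \<open>The number of nonzero paths starting at \<open>a\<close>, that is
  \<open>dim P_a\<close>.\<close>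

definition plen :: "nat \<Rightarrow> nat" where
  "plen a = (LEAST l. zero_path n \<rho> a l)"

lemma plen_zero_iff: "a \<in> {1..n} \<Longrightarrow> zero_path n \<rho> a l \<longleftrightarrow> plen a \<le> l"
  unfolding plen_def using zero_path_exists
  by (meson LeastI_ex Least_le zero_path_mono)

lemma plen_pos: "a \<in> {1..n} \<Longrightarrow> 1 \<le> plen a"
proof (rule ccontr)
  assume a: "a \<in> {1..n}" and "\<not> 1 \<le> plen a"
  then have "zero_path n \<rho> a 0" by (simp add: plen_zero_iff)
  then show False using nak by (auto simp: zero_path_def nakayama_algebra_def)
qed

text \<open>The Kupisch inequality: a zero path stays zero when an arrow is put in front of it. It
  becomes the monotonicity of \<open>res\<close>.\<close>

lemma plen_rot: "a \<in> {1..n} \<Longrightarrow> plen a \<le> plen (rot n a) + 1"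
  using zero_path_extend[of n \<rho> 1 a "plen (rot n a)"] rot_vertex[of a n 1]
  by (simp flip: plen_zero_iff) (simp add: plen_zero_iff)

lemma pth_eq_0_iff: "a \<in> {1..n} \<Longrightarrow> pth a l = \<zero>\<^bsub>A\<^esub> \<longleftrightarrow> plen a \<le> l"
  by (simp add: pth_zero_iff plen_zero_iff)

end

section \<open>Linear algebra and right modules\<close>

lemma sum_apply: "(\<Sum>j\<in>J. f j) i = (\<Sum>j\<in>J. f j (i::nat) :: 'k::field)"
  by (induction J rule: infinite_finite_induct) simp_all

lemma vscale_apply: "vscale c v i = c * v i"
  by (simp add: vscale_def)

text \<open>Linearity is asked on \<open>V\<close> only, since the values of a homomorphism outside
  its source are arbitrary.\<close>

definition linear_on :: "(nat \<Rightarrow> 'k::field) set \<Rightarrow> ((nat \<Rightarrow> 'k) \<Rightarrow> (nat \<Rightarrow> 'k)) \<Rightarrow> bool" where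
  "linear_on V T \<longleftrightarrow> (\<forall>x\<in>V. \<forall>y\<in>V. T (x + y) = T x + T y) \<and> (\<forall>x\<in>V. \<forall>c. T (vscale c x) = vscale c (T x))"

lemma linear_on_sum:
  assumes V: "kvec.subspace V" and T: "linear_on V T" and x: "\<And>j. j \<in> J \<Longrightarrow> x j \<in> V"
  shows "T (\<Sum>j\<in>J. vscale (c j) (x j)) = (\<Sum>j\<in>J. vscale (c j) (T (x j)))"
proof -
  have "T (vscale 0 0) = vscale 0 (T 0)" using T kvec.subspace_0[OF V] unfolding linear_on_def by blast
  then have 0: "T 0 = 0" by simp
  show ?thesis
    using x
  proof (induction J rule: infinite_finite_induct)
    case (insert a J)
    have "(\<Sum>j\<in>J. vscale (c j) (x j)) \<in> V" "vscale (c a) (x a) \<in> V"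
      using insert.prems by (blast intro: kvec.subspace_sum[OF V] kvec.subspace_scale[OF V])+
    then have "T (vscale (c a) (x a) + (\<Sum>j\<in>J. vscale (c j) (x j))) =
        vscale (c a) (T (x a)) + T (\<Sum>j\<in>J. vscale (c j) (x j))"
      using T insert.prems unfolding linear_on_def by (metis insertI1)
    then show ?case
      unfolding sum.insert[OF insert.hyps] using insert.IH insert.prems by (metis insertI2)
  qed (simp_all only: sum.infinite sum.empty 0 if_True not_False_eq_True)
qed

lemma linear_on_zero: "kvec.subspace V \<Longrightarrow> linear_on V T \<Longrightarrow> T 0 = 0"
  using linear_on_sum[of V T "{}"] by simp

lemma linear_on_basis_image:
  assumes V: "kvec.subspace V" and C: "finite C" "V \<subseteq> kvec.span C"
    and T: "linear_on V T" and inj: "\<And>x. x \<in> V \<Longrightarrow> T x = 0 \<Longrightarrow> x = 0"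
  obtains B where "finite B" "B \<subseteq> V" "V \<subseteq> kvec.span B" "kvec.independent (T ` B)" "card (T ` B) = kvec.dim V"
proof -
  obtain B where B: "B \<subseteq> V" "kvec.independent B" "V \<subseteq> kvec.span B" "card B = kvec.dim V"
    using kvec.basis_exists[of V] by metis
  have fin: "finite B" using kvec.independent_span_bound[OF C(1) B(2)] B(1) C(2) by blast
  have injT: "inj_on T V"
  proof (rule inj_onI)
    fix x y assume xy: "x \<in> V" "y \<in> V" "T x = T y"
    then have m: "vscale (- 1) y \<in> V" using V kvec.subspace_scale by blast
    have "T (x + vscale (- 1) y) = T x + vscale (- 1) (T y)"
      using T xy m unfolding linear_on_def by metis
    also have "\<dots> = 0" using xy by (auto simp: vscale_def fun_eq_iff)
    finally have "x + vscale (- 1) y = 0" using inj xy m V kvec.subspace_add by blast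
    then show "x = y" by (auto simp: vscale_def fun_eq_iff)
  qed
  then have injB: "inj_on T B" using B(1) inj_on_subset by blast
  have "kvec.independent (T ` B)"
  proof (rule kvec.independent_if_scalars_zero)
    fix u w assume s: "(\<Sum>w\<in>T ` B. vscale (u w) w) = 0" and w: "w \<in> T ` B"
    have "T (\<Sum>v\<in>B. vscale (u (T v)) v) = (\<Sum>v\<in>B. vscale (u (T v)) (T v))"
      using B(1) by (intro linear_on_sum[OF V T]) auto
    also have "\<dots> = 0" using s by (simp add: sum.reindex[OF injB])
    finally have 0: "T (\<Sum>v\<in>B. vscale (u (T v)) v) = 0" .
    have "(\<Sum>v\<in>B. vscale (u (T v)) v) \<in> V"
      by (intro kvec.subspace_sum[OF V] kvec.subspace_scale[OF V]) (use B(1) in blast)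
    from inj[OF this 0] have "(\<Sum>v\<in>B. vscale (u (T v)) v) = 0" .
    moreover obtain v where v: "v \<in> B" "w = T v" using w by blast
    ultimately show "u w = 0"
      using kvec.independentD[OF B(2) fin order.refl, of "\<lambda>v. u (T v)" v] by simp
  qed (use fin in simp)
  with that fin B card_image[OF injB] show ?thesis by metis
qed

lemma dim_le_linear_inj:
  assumes V: "kvec.subspace V" "finite C" "V \<subseteq> kvec.span C"
    and T: "linear_on V T" "\<And>x. x \<in> V \<Longrightarrow> T x = 0 \<Longrightarrow> x = 0"
    and W: "T ` V \<subseteq> W" "finite D" "W \<subseteq> kvec.span D"
  shows "kvec.dim V \<le> kvec.dim W"
proof -
  obtain B where B: "finite B" "B \<subseteq> V" "kvec.independent (T ` B)" "card (T ` B) = kvec.dim V"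
    using linear_on_basis_image[OF V T] by metis
  obtain E where E: "E \<subseteq> W" "kvec.independent E" "W \<subseteq> kvec.span E" "card E = kvec.dim W"
    using kvec.basis_exists[of W] by metis
  have "finite E" using kvec.independent_span_bound[OF W(2) E(2)] E(1) W(3) by blast
  moreover have "T ` B \<subseteq> kvec.span E" using B(2) W(1) E(3) by blast
  ultimately show ?thesis using kvec.independent_span_bound[OF _ B(3)] B(4) E(4) by metis
qed

lemma dim_eq_linear_bij:
  assumes V: "kvec.subspace V" "finite C" "V \<subseteq> kvec.span C"
    and T: "linear_on V T" "bij_betw T V W"
  shows "kvec.dim V = kvec.dim W"
proof -
  have inj: "x = 0" if "x \<in> V" "T x = 0" for x
    using that T(2) linear_on_zero[OF V(1) T(1)] kvec.subspace_0[OF V(1)]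
    by (auto simp: bij_betw_def inj_on_def)
  obtain B where B: "finite B" "B \<subseteq> V" "V \<subseteq> kvec.span B" "kvec.independent (T ` B)" "card (T ` B) = kvec.dim V"
    using linear_on_basis_image[OF V T(1) inj] by metis
  have "W \<subseteq> kvec.span (T ` B)"
  proof
    fix w assume "w \<in> W"
    then obtain x where x: "x \<in> V" "w = T x" using T(2) by (auto simp: bij_betw_def)
    then obtain u where "x = (\<Sum>v\<in>B. vscale (u v) v)"
      using B(3) kvec.span_finite[OF B(1)] by blast
    then have "w = (\<Sum>v\<in>B. vscale (u v) (T v))"
      using x(2) linear_on_sum[OF V(1) T(1), of B "\<lambda>v. v"] B(2) by auto
    then show "w \<in> kvec.span (T ` B)"
      by (simp only:) (intro kvec.span_sum kvec.span_scale kvec.span_base imageI; simp)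
  qed
  moreover have "T ` B \<subseteq> W" using B(2) T(2) by (auto simp: bij_betw_def)
  ultimately show ?thesis using kvec.basis_card_eq_dim[of "T ` B" W] B by simp
qed

text \<open>Independence of an indexed family also excludes repetitions: \<open>b i = b j\<close>
  would give the relation with coefficients 1 and -1.\<close>

lemma dim_eq_family:
  fixes b :: "nat \<Rightarrow> nat \<Rightarrow> 'k::field"
  assumes b: "\<And>j. j < l \<Longrightarrow> b j \<in> V"
    and span: "\<And>u. u \<in> V \<Longrightarrow> \<exists>t. u = (\<Sum>j<l. vscale (t j) (b j))"
    and indep: "\<And>t j. (\<Sum>j<l. vscale (t j) (b j)) = 0 \<Longrightarrow> j < l \<Longrightarrow> t j = 0"
  shows "kvec.dim V = l"
proof -
  have inj: "inj_on b {..<l}"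
  proof (rule inj_onI, rule ccontr)
    fix i j assume ij: "i \<in> {..<l}" "j \<in> {..<l}" "b i = b j" "i \<noteq> j"
    let ?t = "\<lambda>m. if m = i then 1 else if m = j then - 1 else (0 :: 'k)"
    have "(\<Sum>m<l. vscale (?t m) (b m)) = (\<Sum>m\<in>{i, j}. vscale (?t m) (b m))"
      by (rule sum.mono_neutral_right) (use ij in auto)
    also have "\<dots> = 0" using ij by (auto simp: vscale_def fun_eq_iff)
    finally show False using indep[of ?t i] ij by simp
  qed
  have "kvec.independent (b ` {..<l})"
  proof (rule kvec.independent_if_scalars_zero)
    fix u w assume s: "(\<Sum>w\<in>b ` {..<l}. vscale (u w) w) = 0" and "w \<in> b ` {..<l}"
    then obtain j where "j < l" "w = b j" by blast
    then show "u w = 0" using indep[of "\<lambda>j. u (b j)" j] s by (simp add: sum.reindex[OF inj])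
  qed simp
  moreover have "V \<subseteq> kvec.span (b ` {..<l})"
  proof
    fix u assume "u \<in> V"
    then obtain t where "u = (\<Sum>j<l. vscale (t j) (b j))" using span by blast
    then show "u \<in> kvec.span (b ` {..<l})"
      by (simp only:) (intro kvec.span_sum kvec.span_scale kvec.span_base imageI; simp)
  qed
  moreover have "b ` {..<l} \<subseteq> V" using b by auto
  ultimately show ?thesis using kvec.basis_card_eq_dim[of "b ` {..<l}" V] card_image[OF inj] by simp
qed

section \<open>Right modules, submodules and homomorphisms\<close>

lemma
  assumes "right_module A M"
  shows rm_subspace: "kvec.subspace (space M)"
    and rm_finite: "\<exists>B. finite B \<and> space M \<subseteq> kvec.span B"
    and rm_closed: "\<lbrakk>x \<in> space M; r \<in> carrier A\<rbrakk> \<Longrightarrow> act M x r \<in> space M"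
    and rm_add: "\<lbrakk>x \<in> space M; y \<in> space M; r \<in> carrier A\<rbrakk> \<Longrightarrow> act M (x + y) r = act M x r + act M y r"
    and rm_add_right: "\<lbrakk>x \<in> space M; r \<in> carrier A; s \<in> carrier A\<rbrakk> \<Longrightarrow> act M x (r \<oplus>\<^bsub>A\<^esub> s) = act M x r + act M x s"
    and rm_mult: "\<lbrakk>x \<in> space M; r \<in> carrier A; s \<in> carrier A\<rbrakk> \<Longrightarrow> act M x (r \<otimes>\<^bsub>A\<^esub> s) = act M (act M x r) s"
    and rm_one: "x \<in> space M \<Longrightarrow> act M x \<one>\<^bsub>A\<^esub> = x"
    and rm_smult_right: "\<lbrakk>x \<in> space M; r \<in> carrier A\<rbrakk> \<Longrightarrow> act M x (c \<odot>\<^bsub>A\<^esub> r) = vscale c (act M x r)"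
    and rm_smult: "\<lbrakk>x \<in> space M; r \<in> carrier A\<rbrakk> \<Longrightarrow> act M (vscale c x) r = vscale c (act M x r)"
  using assms unfolding right_module_def by auto

lemma rm_linear: "right_module A M \<Longrightarrow> r \<in> carrier A \<Longrightarrow> linear_on (space M) (\<lambda>x. act M x r)"
  by (simp add: linear_on_def rm_add rm_smult)

lemma rm_zero: "right_module A M \<Longrightarrow> r \<in> carrier A \<Longrightarrow> act M 0 r = 0"
  by (rule linear_on_zero[OF rm_subspace rm_linear])

lemma rm_submodule:
  assumes M: "right_module A M" and U: "submodule A M U"
  shows "right_module A (M\<lparr>space := U\<rparr>)"
proof -
  have UM: "U \<subseteq> space M" and sub: "kvec.subspace U" using U by (auto simp: submodule_def)
  obtain C where C: "finite C" "space M \<subseteq> kvec.span C" using rm_finite[OF M] by blast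
  obtain B where B: "B \<subseteq> U" "kvec.independent B" "U \<subseteq> kvec.span B"
    using kvec.basis_exists[of U] by metis
  have "finite B" using kvec.independent_span_bound[OF C(1) B(2)] B(1) UM C(2) by blast
  moreover have "kvec.span B = U" using kvec.span_minimal[OF B(1) sub] B(3) by blast
  ultimately have "\<exists>B. finite B \<and> kvec.span B = U" by blast
  then show ?thesis
    using M U UM sub unfolding right_module_def submodule_def by (simp add: subset_iff)
qed

lemma hom_linear:
  assumes A: "fd_algebra A" and M: "right_module A M" and N: "right_module A N" and f: "is_hom A M N f"
  shows "linear_on (space M) f"
  unfolding linear_on_def
proof (intro conjI ballI allI)
  fix x c assume x: "x \<in> space M"
  interpret A: fd_algebra A by fact
  have c: "c \<odot>\<^bsub>A\<^esub> \<one>\<^bsub>A\<^esub> \<in> carrier A" by (simp add: A.smult_closed)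
  have "f (vscale c x) = f (act M x (c \<odot>\<^bsub>A\<^esub> \<one>\<^bsub>A\<^esub>))"
    using rm_smult_right[OF M x] rm_one[OF M x] by simp
  also have "\<dots> = act N (f x) (c \<odot>\<^bsub>A\<^esub> \<one>\<^bsub>A\<^esub>)" using f x c by (simp add: is_hom_def)
  also have "\<dots> = vscale c (f x)"
    using f x rm_smult_right[OF N, of "f x" "\<one>\<^bsub>A\<^esub>"] rm_one[OF N] by (simp add: is_hom_def)
  finally show "f (vscale c x) = vscale c (f x)" .
qed (use f in \<open>simp add: is_hom_def\<close>)

lemma ker_submodule:
  assumes A: "fd_algebra A" and M: "right_module A M" and N: "right_module A N" and f: "is_hom A M N f"
  shows "submodule A M (ker_space M f)"
proof -
  note lin = hom_linear[OF assms]
  note sub = rm_subspace[OF M]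
  have "kvec.subspace (ker_space M f)"
    using lin linear_on_zero[OF sub lin] sub
    by (auto simp: kvec.subspace_def ker_space_def linear_on_def)
  moreover have "f (act M x r) = 0" if "x \<in> ker_space M f" "r \<in> carrier A" for x r
    using that f rm_zero[OF N] by (simp add: is_hom_def ker_space_def)
  ultimately show ?thesis
    using rm_closed[OF M] by (auto simp: submodule_def ker_space_def)
qed

lemma module_iso_mdim:
  assumes A: "fd_algebra A" and M: "right_module A M" and N: "right_module A N" and "module_iso A M N"
  shows "mdim M = mdim N"
proof -
  obtain f where f: "is_hom A M N f" "bij_betw f (space M) (space N)"
    using assms(4) by (auto simp: module_iso_def)
  obtain C where "finite C" "space M \<subseteq> kvec.span C" using rm_finite[OF M] by blast
  then show ?thesis
    unfolding mdim_def using dim_eq_linear_bij[OF rm_subspace[OF M] _ _ hom_linear[OF A M N f(1)] f(2)] by blast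
qed

section \<open>Uniserial modules\<close>

lemma span_singletonE: "x \<in> kvec.span {z} \<Longrightarrow> \<exists>m. x = vscale m z"
  using kvec.span_singleton[of z] by auto

context nakayama
begin

lemma act_zero_right: "right_module A M \<Longrightarrow> x \<in> space M \<Longrightarrow> act M x \<zero>\<^bsub>A\<^esub> = 0"
  using rm_add_right[of A M x "\<zero>\<^bsub>A\<^esub>" "\<zero>\<^bsub>A\<^esub>"] by simp

lemma act_pth:
  assumes "right_module A M" "v \<in> space M" "a \<in> {1..n}" "b \<in> {1..n}"
  shows "act M (act M v (pth a j)) (pth b i) = (if b = (rot n ^^ j) a then act M v (pth a (j + i)) else 0)"
proof -
  have "act M (act M v (pth a j)) (pth b i) = act M v (pth a j \<otimes>\<^bsub>A\<^esub> pth b i)"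
    using assms by (simp add: rm_mult pth_closed del: atLeastAtMost_iff)
  then show ?thesis using assms by (simp add: pth_mult act_zero_right del: atLeastAtMost_iff)
qed

lemma act_pth_long: "right_module A M \<Longrightarrow> v \<in> space M \<Longrightarrow> a \<in> {1..n} \<Longrightarrow> plen a \<le> j \<Longrightarrow> act M v (pth a j) = 0"
  using act_zero_right pth_eq_0_iff by metis

lemma act_pth_mono:
  assumes "right_module A M" "v \<in> space M" "a \<in> {1..n}" "act M v (pth a j) = 0" "j \<le> k"
  shows "act M v (pth a k) = 0"
proof -
  have b: "(rot n ^^ j) a \<in> {1..n}" using assms(3) by (rule rot_vertex)
  have "act M v (pth a (j + (k - j))) = act M (act M v (pth a j)) (pth ((rot n ^^ j) a) (k - j))"
    unfolding act_pth[OF assms(1-3) b] by simp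
  also have "\<dots> = 0" using assms(4) rm_zero[OF assms(1) pth_closed[OF b]] by simp
  finally show ?thesis using assms(5) by simp
qed

lemma act_combination:
  assumes "right_module A M" "r \<in> carrier A" "\<And>j. j \<in> J \<Longrightarrow> x j \<in> space M"
  shows "act M (\<Sum>j\<in>J. vscale (t j) (x j)) r = (\<Sum>j\<in>J. vscale (t j) (act M (x j) r))"
  by (rule linear_on_sum[OF rm_subspace rm_linear]) (use assms in auto)

lemma is_homI_pth:
  assumes M: "right_module A M" and N: "right_module A N"
    and f: "\<And>x. x \<in> space M \<Longrightarrow> f x \<in> space N" "linear_on (space M) f"
    and p: "\<And>x b i. x \<in> space M \<Longrightarrow> b \<in> {1..n} \<Longrightarrow> f (act M x (pth b i)) = act N (f x) (pth b i)"
  shows "is_hom A M N f"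
proof -
  have "f (act M x r) = act N (f x) r" if "r \<in> carrier A" "x \<in> space M" for x r
    using that
  proof (induction r rule: algebra_induct)
    case zero then show ?case
      using linear_on_zero[OF rm_subspace[OF M] f(2)] f(1) by (metis act_zero_right[OF M] act_zero_right[OF N])
  next
    case (add r s)
    then have "f (act M x r + act M x s) = act N (f x) r + act N (f x) s"
      using f(2) rm_closed[OF M] unfolding linear_on_def by metis
    then show ?case using add f(1) rm_add_right[OF M] rm_add_right[OF N] by metis
  next
    case (smult c r)
    then have "f (vscale c (act M x r)) = vscale c (act N (f x) r)"
      using f(2) rm_closed[OF M] unfolding linear_on_def by metis
    then show ?case using smult f(1) rm_smult_right[OF M] rm_smult_right[OF N] by metis
  qed (use p in blast)
  then show ?thesis using f by (auto simp: is_hom_def linear_on_def)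
qed

lemma submoduleI_pth:
  assumes M: "right_module A M" and U: "U \<subseteq> space M" "kvec.subspace U"
    and p: "\<And>x b i. x \<in> U \<Longrightarrow> b \<in> {1..n} \<Longrightarrow> act M x (pth b i) \<in> U"
  shows "submodule A M U"
proof -
  have "act M x r \<in> U" if "r \<in> carrier A" "x \<in> U" for x r
    using that
  proof (induction r rule: algebra_induct)
    case zero then show ?case using act_zero_right[OF M, of x] kvec.subspace_0[OF U(2)] U(1) by (metis subsetD)
  next
    case (add r s)
    then have "act M x (r \<oplus>\<^bsub>A\<^esub> s) = act M x r + act M x s" using U by (intro rm_add_right[OF M]) auto
    then show ?case using add kvec.subspace_add[OF U(2)] by metis
  next
    case (smult c r)
    then have "act M x (c \<odot>\<^bsub>A\<^esub> r) = vscale c (act M x r)" using U by (intro rm_smult_right[OF M]) auto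
    then show ?case using smult kvec.subspace_scale[OF U(2)] by metis
  qed (use p in blast)
  then show ?thesis using U by (auto simp: submodule_def)
qed

text \<open>\<open>z\<close> is a socle vector at the vertex \<open>b\<close>: trivial paths fix it
  or kill it, and all longer paths kill it.\<close>

lemma span_submodule:
  assumes M: "right_module A M" and z: "z \<in> space M" "b \<in> {1..n}" "act M z (pth b 0) = z"
    and k: "\<And>i. 1 \<le> i \<Longrightarrow> act M z (pth b i) = 0"
  shows "submodule A M (kvec.span {z})"
proof (rule submoduleI_pth[OF M])
  show "kvec.span {z} \<subseteq> space M" using z rm_subspace[OF M] by (intro kvec.span_minimal) auto
  show "kvec.subspace (kvec.span {z})" by simp
  fix x c i assume x: "x \<in> kvec.span {z}" and c: "c \<in> {1..n}"
  then obtain m where m: "x = vscale m z" using span_singletonE by metis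
  have "act M z (pth c i) = (if c = b \<and> i = 0 then z else 0)"
    using act_pth[OF M z(1,2) c, of 0 i] z k[of i] by (cases "i = 0") auto
  then show "act M x (pth c i) \<in> kvec.span {z}"
    using m rm_smult[OF M z(1) pth_closed[OF c]] x kvec.span_zero by auto
qed

text \<open>Some trivial path does not kill \<open>x\<close>, since otherwise all of
  \<open>A\<close>, and with it the unit, would. From that vertex one follows the longest path that
  does not kill \<open>x\<close>; its length is bounded by \<open>plen\<close>.\<close>

lemma socle_exists:
  assumes M: "right_module A M" and x: "x \<in> space M" "x \<noteq> 0"
  obtains c j where "c \<in> {1..n}" "j < plen c" "act M x (pth c j) \<noteq> 0"
    "\<And>i. 1 \<le> i \<Longrightarrow> act M (act M x (pth c j)) (pth ((rot n ^^ j) c) i) = 0"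
proof -
  have "\<exists>c\<in>{1..n}. act M x (pth c 0) \<noteq> 0"
  proof (rule ccontr)
    assume "\<not> ?thesis"
    then have 0: "act M x (pth c 0) = 0" if "c \<in> {1..n}" for c using that by blast
    have "act M x r = 0" if "r \<in> carrier A" for r
      using that
    proof (induction r rule: algebra_induct)
      case (pth a l) then show ?case using act_pth_mono[OF M x(1) _ 0] by blast
    next
      case (add r s) then show ?case using rm_add_right[OF M x(1)] by (metis add_0)
    next
      case (smult c r) then show ?case using rm_smult_right[OF M x(1)] by (metis kvec.scale_zero_right)
    qed (rule act_zero_right[OF M x(1)])
    then have "act M x \<one>\<^bsub>A\<^esub> = 0" by simp
    then show False using rm_one[OF M x(1)] x(2) by simp
  qed
  then obtain c where c: "c \<in> {1..n}" "act M x (pth c 0) \<noteq> 0" by blast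
  define j where "j = Max {i. act M x (pth c i) \<noteq> 0}"
  have bd: "i < plen c" if "act M x (pth c i) \<noteq> 0" for i
    using act_pth_long[OF M x(1) c(1)] that not_less by blast
  have fin: "finite {i. act M x (pth c i) \<noteq> 0}"
    by (rule finite_subset[OF subsetI finite_lessThan], drule CollectD, rule lessThan_iff[THEN iffD2], rule bd)
  have "{i. act M x (pth c i) \<noteq> 0} \<noteq> {}" using c(2) by blast
  from Max_in[OF fin this] have j: "act M x (pth c j) \<noteq> 0" unfolding j_def by (rule CollectD)
  have "act M x (pth c i) = 0" if "j < i" for i
  proof (rule ccontr)
    assume "act M x (pth c i) \<noteq> 0"
    then have "i \<le> j" unfolding j_def by (rule Max_ge[OF fin CollectI])
    then show False using that by simp
  qed
  then have "act M (act M x (pth c j)) (pth ((rot n ^^ j) c) i) = 0" if "1 \<le> i" for i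
    using act_pth[OF M x(1) c(1) rot_vertex[OF c(1), of j]] that by simp
  with that c(1) j bd show ?thesis by blast
qed

text \<open>The nonzero path multiples of \<open>v\<close> form a basis, listed from the top at
  \<open>a\<close> down to the socle. The value \<open>l = 0\<close> describes the zero module,
  which occurs as the kernel of a cover that is an isomorphism.\<close>

definition uniserial :: "('a, 'k) rmodule \<Rightarrow> (nat \<Rightarrow> 'k) \<Rightarrow> nat \<Rightarrow> nat \<Rightarrow> bool" where
  "uniserial M v a l \<longleftrightarrow> a \<in> {1..n} \<and> v \<in> space M \<and> act M v (pth a 0) = v \<and>
     (\<forall>j. act M v (pth a j) = 0 \<longleftrightarrow> l \<le> j) \<and>
     (\<forall>u\<in>space M. \<exists>t. u = (\<Sum>j<l. vscale (t j) (act M v (pth a j))))"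

text \<open>The relation is multiplied by the path of length \<open>l - 1 - j\<close> that starts
  where the \<open>j\<close>-th path ends. Later terms become too long, earlier coefficients vanish
  by induction, and the last nonzero multiple of \<open>v\<close> remains, with coefficient
  \<open>t j\<close>.\<close>

lemma uniserial_independent:
  assumes M: "right_module A M" and v: "v \<in> space M" "a \<in> {1..n}" "\<And>j. act M v (pth a j) = 0 \<longleftrightarrow> l \<le> j"
    and t: "(\<Sum>j<l. vscale (t j) (act M v (pth a j))) = 0" and j: "j < l"
  shows "t j = 0"
  using j
proof (induction j rule: less_induct)
  case (less j)
  let ?b = "(rot n ^^ j) a"
  have b: "?b \<in> {1..n}" using v(2) by (rule rot_vertex)
  have cl: "act M v (pth a i) \<in> space M" for i by (intro rm_closed[OF M v(1)] pth_closed v)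
  have "0 = act M (\<Sum>i<l. vscale (t i) (act M v (pth a i))) (pth ?b (l - 1 - j))"
    unfolding t using rm_zero[OF M pth_closed[OF b]] by simp
  also have "\<dots> = (\<Sum>i<l. vscale (t i) (act M (act M v (pth a i)) (pth ?b (l - 1 - j))))"
    by (rule act_combination[OF M pth_closed[OF b] cl])
  also have "\<dots> = (\<Sum>i\<in>{j}. vscale (t i) (act M (act M v (pth a i)) (pth ?b (l - 1 - j))))"
  proof (rule sum.mono_neutral_right)
    show "\<forall>i\<in>{..<l} - {j}. vscale (t i) (act M (act M v (pth a i)) (pth ?b (l - 1 - j))) = 0"
    proof
      fix i assume i: "i \<in> {..<l} - {j}"
      show "vscale (t i) (act M (act M v (pth a i)) (pth ?b (l - 1 - j))) = 0"
      proof (cases "i < j")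
        case True then show ?thesis using less by simp
      next
        case False
        then have "act M v (pth a (i + (l - 1 - j))) = 0" using i less v(3) by auto
        then show ?thesis unfolding act_pth[OF M v(1,2) b] by simp
      qed
    qed
  qed (use less in auto)
  also have "\<dots> = vscale (t j) (act M v (pth a (l - 1)))"
    unfolding act_pth[OF M v(1,2) b] using less by simp
  finally have "vscale (t j) (act M v (pth a (l - 1))) = 0" by simp
  moreover have "act M v (pth a (l - 1)) \<noteq> 0" using v(3) less by auto
  ultimately show ?case by (simp add: kvec.scale_eq_0_iff)
qed

lemma mdim_uniserial:
  assumes M: "right_module A M" and u: "uniserial M v a l"
  shows "mdim M = l"
  unfolding mdim_def
proof (rule dim_eq_family)
  show "act M v (pth a j) \<in> space M" for j
    using u by (auto simp: uniserial_def intro!: rm_closed[OF M] pth_closed)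
  show "\<exists>t. x = (\<Sum>j<l. vscale (t j) (act M v (pth a j)))" if "x \<in> space M" for x
    using u that by (auto simp: uniserial_def)
  show "t j = 0" if "(\<Sum>j<l. vscale (t j) (act M v (pth a j))) = 0" "j < l" for t j
    using uniserial_independent[OF M _ _ _ that] u by (auto simp: uniserial_def)
qed

text \<open>A socle vector spans a submodule, hence the whole simple module, and its vertex must be
  \<open>b\<close> because the idempotent at \<open>b\<close> does not annihilate the
  module.\<close>

lemma simple_at_uniserial:
  assumes b: "b \<in> {1..n}" and S: "simple_at A (vertex_idem n \<rho> \<phi> b) S"
  shows "\<exists>s. uniserial S s b 1"
proof -
  have M: "right_module A S" and simp: "\<And>U. submodule A S U \<Longrightarrow> U = {0} \<or> U = space S"
    and ne: "space S \<noteq> {0}" and e: "\<exists>x\<in>space S. act S x (pth b 0) \<noteq> 0"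
    using S by (auto simp: simple_at_def simple_module_def vertex_idem_def pth_def cls_def)
  obtain x where x: "x \<in> space S" "x \<noteq> 0" using ne kvec.subspace_0[OF rm_subspace[OF M]] by blast
  obtain c j where c: "c \<in> {1..n}" "act S x (pth c j) \<noteq> 0"
    and k: "\<And>i. 1 \<le> i \<Longrightarrow> act S (act S x (pth c j)) (pth ((rot n ^^ j) c) i) = 0"
    using socle_exists[OF M x] by metis
  define z where "z = act S x (pth c j)"
  define d where "d = (rot n ^^ j) c"
  have d: "d \<in> {1..n}" unfolding d_def using c(1) by (rule rot_vertex)
  have z: "z \<in> space S" unfolding z_def by (intro rm_closed[OF M x(1)] pth_closed c)
  have zd: "act S z (pth d 0) = z" unfolding z_def d_def using act_pth[OF M x(1) c(1) rot_vertex[OF c(1), of j]] by simp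
  have k': "act S z (pth d i) = 0" if "1 \<le> i" for i using k that by (simp add: z_def d_def)
  have "z \<in> kvec.span {z}" by (simp add: kvec.span_base)
  then have S_eq: "space S = kvec.span {z}"
    using simp[OF span_submodule[OF M z d zd k']] c(2) z_def by auto
  obtain y where y: "y \<in> space S" "act S y (pth b 0) \<noteq> 0" using e by blast
  then obtain m where m: "y = vscale m z" using S_eq span_singletonE by metis
  have "act S z (pth b 0) \<noteq> 0" using y(2) unfolding m rm_smult[OF M z pth_closed[OF b]] by auto
  then have "b = d" using act_pth[OF M z d b, of 0 0] zd by (simp split: if_splits)
  have "uniserial S z b 1"
    unfolding uniserial_def
  proof (intro conjI allI ballI)
    show "act S z (pth b i) = 0 \<longleftrightarrow> 1 \<le> i" for i
      using k' zd c(2) \<open>b = d\<close> unfolding z_def[symmetric] by (cases "i = 0") auto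
    fix u assume "u \<in> space S"
    then obtain t where "u = vscale t z" using S_eq span_singletonE by metis
    then show "\<exists>t. u = (\<Sum>j<1. vscale (t j) (act S z (pth b j)))"
      using zd \<open>b = d\<close> by (intro exI[of _ "\<lambda>_. t"]) simp
  qed (use z zd b \<open>b = d\<close> in auto)
  then show ?thesis by (rule exI[where x = z])
qed

end

section \<open>Concrete uniserial modules\<close>

definition unit_seq :: "nat \<Rightarrow> nat \<Rightarrow> 'k::field" where
  "unit_seq j = (\<lambda>i. if i = j then 1 else 0)"

lemma supported_subspace: "kvec.subspace {v :: nat \<Rightarrow> 'k::field. \<forall>i\<ge>l. v i = 0}"
  by (auto simp: kvec.subspace_def vscale_def)

lemma supported_expand: "\<forall>i\<ge>l. v i = (0::'k::field) \<Longrightarrow> v = (\<Sum>j<l. vscale (v j) (unit_seq j))"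
proof
  fix i assume v: "\<forall>i\<ge>l. v i = 0"
  have "(\<Sum>j<l. vscale (v j) (unit_seq j)) i = (\<Sum>j<l. if j = i then v i else 0)"
    unfolding sum_apply by (rule sum.cong) (auto simp: vscale_def unit_seq_def)
  also have "\<dots> = v i" using v by (auto simp: not_less)
  finally show "v i = (\<Sum>j<l. vscale (v j) (unit_seq j)) i" by simp
qed

lemma supported_span: "kvec.span (unit_seq ` {..<l}) = {v :: nat \<Rightarrow> 'k::field. \<forall>i\<ge>l. v i = 0}"
proof
  show "kvec.span (unit_seq ` {..<l}) \<subseteq> {v :: nat \<Rightarrow> 'k. \<forall>i\<ge>l. v i = 0}"
    by (rule kvec.span_minimal[OF _ supported_subspace]) (auto simp: unit_seq_def)
  show "{v :: nat \<Rightarrow> 'k. \<forall>i\<ge>l. v i = 0} \<subseteq> kvec.span (unit_seq ` {..<l})"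
  proof
    fix v :: "nat \<Rightarrow> 'k" assume "v \<in> {v. \<forall>i\<ge>l. v i = 0}"
    then have "v = (\<Sum>j<l. vscale (v j) (unit_seq j))" using supported_expand by blast
    moreover have "(\<Sum>j<l. vscale (v j) (unit_seq j)) \<in> kvec.span (unit_seq ` {..<l})"
      by (intro kvec.span_sum kvec.span_scale kvec.span_base imageI)
    ultimately show "v \<in> kvec.span (unit_seq ` {..<l})" by (simp only:)
  qed
qed

context nakayama
begin

text \<open>Coordinate \<open>i < l\<close> stands for the path of length \<open>i\<close> starting at \<open>a\<close>. The module laws hold only
  for \<open>l \<le> plen a\<close>: then all these paths are nonzero and the action does not depend on the chosen
  representative.\<close>

definition seg :: "nat \<Rightarrow> nat \<Rightarrow> ('a, 'k) rmodule" where
  "seg a l = \<lparr>space = {v. \<forall>i\<ge>l. v i = 0},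
     act = (\<lambda>v r i. if i < l
        then ((\<lambda>(b, j). if b = a then v j else 0) \<otimes>\<^bsub>R\<^esub> (SOME f. f \<in> carrier R \<and> cls f = r)) (a, i) else 0)\<rparr>"

lemma seg_space: "space (seg a l) = {v. \<forall>i\<ge>l. v i = 0}"
  by (simp add: seg_def)

text \<open>Representatives of \<open>cls f\<close> agree on nonzero paths, and the coefficients
  read for coordinate \<open>i\<close> belong to subpaths of the path of length
  \<open>i < plen a\<close> from \<open>a\<close>.\<close>

lemma seg_act:
  assumes a: "a \<in> {1..n}" and l: "l \<le> plen a" and f: "f \<in> carrier R"
  shows "act (seg a l) v (cls f) =
    (\<lambda>i. if i < l then ((\<lambda>(b, j). if b = a then v j else 0) \<otimes>\<^bsub>R\<^esub> f) (a, i) else 0)"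
proof
  fix i
  define g where "g = (SOME g. g \<in> carrier R \<and> cls g = cls f)"
  have g: "g \<in> carrier R \<and> cls g = cls f" unfolding g_def by (rule someI[of _ f]) (simp add: f)
  have "g ((rot n ^^ j) a, i - j) = f ((rot n ^^ j) a, i - j)" if "j \<le> i" "i < l" for j
  proof -
    have "\<not> zero_path n \<rho> ((rot n ^^ j) a) (i - j)"
    proof
      assume "zero_path n \<rho> ((rot n ^^ j) a) (i - j)"
      then have "zero_path n \<rho> a i" by (rule zero_path_extend) (use that in simp)
      then show False using plen_zero_iff[OF a] that l by simp
    qed
    then show ?thesis using g cls_eq_iff[of g f] f by blast
  qed
  then show "act (seg a l) v (cls f) i =
    (if i < l then ((\<lambda>(b, j). if b = a then v j else 0) \<otimes>\<^bsub>R\<^esub> f) (a, i) else 0)"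
    unfolding seg_def g_def[symmetric] by (auto simp: path_algebra_simps g_def[symmetric] intro!: sum.cong)
qed

lemma seg_pth:
  assumes a: "a \<in> {1..n}" and l: "l \<le> plen a" and b: "b \<in> {1..n}"
  shows "act (seg a l) v (pth b i) =
    (\<lambda>m. if m < l \<and> i \<le> m \<and> (rot n ^^ (m - i)) a = b then v (m - i) else 0)"
proof
  fix m
  have "(\<Sum>j\<le>m. v j * path_elem (b, i) ((rot n ^^ j) a, m - j)) =
      (\<Sum>j\<le>m. if j = m - i then (if i \<le> m \<and> (rot n ^^ (m - i)) a = b then v (m - i) else 0) else 0)"
    by (rule sum.cong) (auto simp: path_elem_def)
  also have "\<dots> = (if i \<le> m \<and> (rot n ^^ (m - i)) a = b then v (m - i) else 0)" by simp
  finally show "act (seg a l) v (pth b i) m =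
      (if m < l \<and> i \<le> m \<and> (rot n ^^ (m - i)) a = b then v (m - i) else 0)"
    unfolding pth_def seg_act[OF a l path_elem_R[OF b]] by (simp add: path_algebra_simps)
qed

text \<open>Vectors are read as combinations of paths starting at \<open>a\<close>, multiplied in
  the path algebra and cut off at length \<open>l\<close>; the module laws come from the ring laws
  there.\<close>

lemma seg_right_module:
  assumes a: "a \<in> {1..n}" and l: "l \<le> plen a"
  shows "right_module A (seg a l)"
proof -
  let ?e = "\<lambda>v. (\<lambda>(b, j). if b = a then v j else (0::'k))"
  note act = seg_act[OF a l]
  have ex: "\<exists>f. f \<in> carrier R \<and> r = cls f" if "r \<in> carrier A" for r using cls_surj[OF that] by auto
  have 1: "act (seg a l) v r \<in> space (seg a l)" if "r \<in> carrier A" for v r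
    using ex[OF that] act by (auto simp: seg_space)
  have 2: "act (seg a l) (v + w) r = act (seg a l) v r + act (seg a l) w r" if "r \<in> carrier A" for v w r
    using ex[OF that] act by (auto simp: fun_eq_iff path_algebra_simps algebra_simps sum.distrib)
  have 3: "act (seg a l) v (r \<oplus>\<^bsub>A\<^esub> s) = act (seg a l) v r + act (seg a l) v s"
    if rs: "r \<in> carrier A" "s \<in> carrier A" for v r s
  proof -
    obtain f where f: "f \<in> carrier R" "r = cls f" using ex[OF rs(1)] by blast
    obtain g where g: "g \<in> carrier R" "s = cls g" using ex[OF rs(2)] by blast
    show ?thesis unfolding f(2) g(2) cls_add[OF f(1) g(1), symmetric] act[OF add_carrier[OF f(1) g(1)]] act[OF f(1)] act[OF g(1)]
      by (auto simp: fun_eq_iff path_algebra_simps algebra_simps sum.distrib)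
  qed
  have 4: "act (seg a l) v (r \<otimes>\<^bsub>A\<^esub> s) = act (seg a l) (act (seg a l) v r) s"
    if rs: "r \<in> carrier A" "s \<in> carrier A" for v r s
  proof -
    obtain f where f: "f \<in> carrier R" "r = cls f" using ex[OF rs(1)] by blast
    obtain g where g: "g \<in> carrier R" "s = cls g" using ex[OF rs(2)] by blast
    define w where "w = act (seg a l) v (cls f)"
    have w: "w i = (?e v \<otimes>\<^bsub>R\<^esub> f) (a, i)" if "i < l" for i
      unfolding w_def act[OF f(1)] using that by simp
    \<comment> \<open>Cutting off before the second multiplication is harmless: coordinate
      \<open>i\<close> of a product involves only coordinates \<open>j \<le> i\<close> of the left
      factor.\<close>
    have "(?e w \<otimes>\<^bsub>R\<^esub> g) (a, i) = (?e v \<otimes>\<^bsub>R\<^esub> (f \<otimes>\<^bsub>R\<^esub> g)) (a, i)" if "i < l" for i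
    proof -
      have "(?e w \<otimes>\<^bsub>R\<^esub> g) (a, i) = ((?e v \<otimes>\<^bsub>R\<^esub> f) \<otimes>\<^bsub>R\<^esub> g) (a, i)"
        unfolding path_algebra_simps(4)[where g = g] by (rule sum.cong) (use w that in auto)
      then show ?thesis unfolding path_mult_assoc .
    qed
    then show ?thesis
      unfolding f(2) g(2) cls_mult[OF f(1) g(1), symmetric] act[OF path_mult_closed[OF f(1) g(1)]]
        w_def[symmetric] act[OF g(1)] by (auto simp: fun_eq_iff)
  qed
  have 5: "act (seg a l) v \<one>\<^bsub>A\<^esub> = v" if "v \<in> space (seg a l)" for v
  proof
    fix i
    have one: "\<one>\<^bsub>R\<^esub> \<in> carrier R" by (rule ring.ring_simprules(6)[OF ring_path_algebra])
    have "(\<Sum>j\<le>i. v j * \<one>\<^bsub>R\<^esub> ((rot n ^^ j) a, i - j)) = (\<Sum>j\<le>i. if j = i then v i else 0)"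
      by (rule sum.cong) (use rot_vertex[OF a] in \<open>auto simp: path_algebra_def\<close>)
    also have "\<dots> = v i" by simp
    finally show "act (seg a l) v \<one>\<^bsub>A\<^esub> i = v i"
      unfolding cls_one[symmetric] act[OF one] using that by (simp add: path_algebra_simps(4) seg_space)
  qed
  have 6: "act (seg a l) v (c \<odot>\<^bsub>A\<^esub> r) = vscale c (act (seg a l) v r)" if rs: "r \<in> carrier A" for v c r
  proof -
    obtain f where f: "f \<in> carrier R" "r = cls f" using ex[OF rs] by blast
    show ?thesis unfolding f(2) cls_smult[OF f(1), symmetric] act[OF smult_carrier[OF f(1)]] act[OF f(1)]
      by (auto simp: fun_eq_iff path_algebra_simps vscale_def sum_distrib_left algebra_simps)
  qed
  have 7: "act (seg a l) (vscale c v) r = vscale c (act (seg a l) v r)" if rs: "r \<in> carrier A" for v c r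
  proof -
    obtain f where f: "f \<in> carrier R" "r = cls f" using ex[OF rs] by blast
    show ?thesis unfolding f(2) act[OF f(1)]
      by (auto simp: fun_eq_iff path_algebra_simps vscale_def sum_distrib_left algebra_simps)
  qed
  have 8: "\<exists>B. finite B \<and> kvec.span B = space (seg a l)"
    unfolding seg_space using supported_span by (intro exI[of _ "unit_seq ` {..<l}"]) simp
  show ?thesis
    unfolding right_module_def using 1 2 3 4 5 6 7 8 supported_subspace[of l] by (simp add: seg_space)
qed

lemma seg_uniserial:
  assumes a: "a \<in> {1..n}" and l: "1 \<le> l" "l \<le> plen a"
  shows "uniserial (seg a l) (unit_seq 0) a l"
proof -
  have p: "act (seg a l) (unit_seq 0) (pth a j) = (if j < l then unit_seq j else 0)" for j
    unfolding seg_pth[OF a l(2) a] by (auto simp: fun_eq_iff unit_seq_def)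
  have nz: "unit_seq j \<noteq> (0 :: nat \<Rightarrow> 'k)" for j
    by (metis unit_seq_def zero_fun_apply zero_neq_one)
  have "\<exists>t. u = (\<Sum>j<l. vscale (t j) (act (seg a l) (unit_seq 0) (pth a j)))" if "u \<in> space (seg a l)" for u
  proof (rule exI[of _ u])
    have "(\<Sum>j<l. vscale (u j) (act (seg a l) (unit_seq 0) (pth a j))) = (\<Sum>j<l. vscale (u j) (unit_seq j))"
      unfolding p by (rule sum.cong) auto
    then show "u = (\<Sum>j<l. vscale (u j) (act (seg a l) (unit_seq 0) (pth a j)))"
      using supported_expand[of l u] that by (simp only: seg_space mem_Collect_eq)
  qed
  moreover have "unit_seq 0 \<in> space (seg a l)" using l by (auto simp: seg_space unit_seq_def)
  moreover have "(if j < l then unit_seq j else 0) = (0 :: nat \<Rightarrow> 'k) \<longleftrightarrow> l \<le> j" for j using nz by auto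
  ultimately show "uniserial (seg a l) (unit_seq 0) a l"
    unfolding uniserial_def using a l p by simp
qed

section \<open>Syzygies of uniserial modules\<close>

text \<open>\<open>seg a (plen a)\<close> maps onto \<open>P\<close>, and projectivity splits this
  map; let \<open>z\<close> be the image of \<open>w\<close> under the section. If \<open>z\<close>
  has a nonzero top coordinate, the longest path does not kill \<open>z\<close>, hence not
  \<open>w\<close>. Otherwise \<open>w\<close> would be a combination of its own multiples by
  nontrivial paths, which its last nonzero multiple refutes.\<close>

lemma projective_uniserial_nonzero:
  assumes P: "projective A P" and w: "w \<in> space P" "w \<noteq> 0" and a: "a \<in> {1..n}" "act P w (pth a 0) = w"
    and gen: "\<And>u. u \<in> space P \<Longrightarrow> \<exists>t. u = (\<Sum>j<plen a. vscale (t j) (act P w (pth a j)))"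
  shows "act P w (pth a (plen a - 1)) \<noteq> 0"
proof
  assume last: "act P w (pth a (plen a - 1)) = 0"
  define c where "c = plen a"
  have c: "1 \<le> c" using plen_pos[OF a(1)] by (simp add: c_def)
  let ?Q = "seg a c"
  have M: "right_module A P" using P by (simp add: projective_def)
  have Q: "right_module A ?Q" by (rule seg_right_module[OF a(1)]) (simp add: c_def)
  have cl: "act P w (pth a j) \<in> space P" for j by (intro rm_closed[OF M w(1)] pth_closed a)
  define g where "g v = (\<Sum>j<c. vscale (v j) (act P w (pth a j)))" for v
  have g_cl: "g v \<in> space P" for v unfolding g_def
    by (intro kvec.subspace_sum kvec.subspace_scale rm_subspace[OF M] cl)
  have "linear_on (space ?Q) g"
    unfolding linear_on_def g_def by (simp add: kvec.scale_left_distrib sum.distrib kvec.scale_sum_right vscale_def[of _ "_ :: nat \<Rightarrow> 'k"] fun_eq_iff sum_apply sum_distrib_left algebra_simps)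
  moreover have "g (act ?Q v (pth b i)) = act P (g v) (pth b i)" if b: "b \<in> {1..n}" for v b i
  proof -
    have "act P (g v) (pth b i) = (\<Sum>j<c. vscale (v j) (act P (act P w (pth a j)) (pth b i)))"
      unfolding g_def by (rule act_combination[OF M pth_closed[OF b] cl])
    \<comment> \<open>Terms with \<open>j + i \<ge> plen a\<close> vanish because the path is zero
      in \<open>A\<close>; this matches the cut-off of coordinates in \<open>seg\<close>.\<close>
    also have "\<dots> = (\<Sum>j<c - i. vscale (v j) (act P (act P w (pth a j)) (pth b i)))"
    proof (rule sum.mono_neutral_right)
      show "\<forall>j\<in>{..<c} - {..<c - i}. vscale (v j) (act P (act P w (pth a j)) (pth b i)) = 0"
      proof
        fix j assume "j \<in> {..<c} - {..<c - i}"
        then have "act P w (pth a (j + i)) = 0" by (intro act_pth_long[OF M w(1) a(1)]) (auto simp: c_def)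
        then show "vscale (v j) (act P (act P w (pth a j)) (pth b i)) = 0"
          unfolding act_pth[OF M w(1) a(1) b] by simp
      qed
    qed auto
    also have "\<dots> = (\<Sum>m\<in>{i..<c}. vscale (act ?Q v (pth b i) m) (act P w (pth a m)))"
    proof (rule sum.reindex_bij_witness[of _ "\<lambda>m. m - i" "\<lambda>j. j + i"])
      fix j assume "j \<in> {..<c - i}"
      then show "vscale (act ?Q v (pth b i) (j + i)) (act P w (pth a (j + i))) =
          vscale (v j) (act P (act P w (pth a j)) (pth b i))"
        unfolding act_pth[OF M w(1) a(1) b] seg_pth[OF a(1) eq_refl[OF c_def] b] by auto
    qed auto
    also have "\<dots> = g (act ?Q v (pth b i))"
      unfolding g_def
    proof (rule sum.mono_neutral_left)
      show "\<forall>m\<in>{..<c} - {i..<c}. vscale (act ?Q v (pth b i) m) (act P w (pth a m)) = 0"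
        unfolding seg_pth[OF a(1) eq_refl[OF c_def] b] by auto
    qed auto
    finally show ?thesis by simp
  qed
  ultimately have g: "is_hom A ?Q P g" using g_cl by (intro is_homI_pth[OF Q M]) auto
  have "g ` space ?Q = space P"
  proof (intro equalityI subsetI)
    fix u assume "u \<in> space P"
    then obtain t where t: "u = (\<Sum>j<c. vscale (t j) (act P w (pth a j)))" using gen unfolding c_def by blast
    have "u = g (\<lambda>i. if i < c then t i else 0)" unfolding g_def t by (rule sum.cong) auto
    then show "u \<in> g ` space ?Q" by (intro image_eqI) (auto simp: seg_space)
  qed (use g_cl in auto)
  then have "is_epi A ?Q P g" using g by (simp add: is_epi_def)
  moreover have "is_hom A P P (\<lambda>x. x)" by (simp add: is_hom_def)
  ultimately obtain h where h: "is_hom A P ?Q h" "\<And>x. x \<in> space P \<Longrightarrow> g (h x) = x"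
    using P Q M unfolding projective_def by blast
  define z where "z = h w"
  have z: "z \<in> space ?Q" "g z = w" using h w(1) unfolding z_def is_hom_def by blast+
  show False
  proof (cases "z 0 = 0")
    case False
    have "h 0 = 0"
      using linear_on_zero[OF rm_subspace[OF M] hom_linear[OF A.fd_algebra_axioms M Q h(1)]] .
    then have "0 = h (act P w (pth a (c - 1)))" using last by (simp add: c_def)
    also have "\<dots> = act ?Q z (pth a (c - 1))"
      using h(1) w(1) pth_closed[OF a(1)] unfolding z_def is_hom_def by blast
    finally have "act ?Q z (pth a (c - 1)) (c - 1) = 0" by (metis zero_fun_apply)
    then show False using False c unfolding seg_pth[OF a(1) eq_refl[OF c_def] a(1)] by auto
  next
    case True
    \<comment> \<open>\<open>j\<close> is the length of a path whose prolongations all kill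
      \<open>w\<close>. Multiplying \<open>w = g z\<close> by it annihilates every term with
      \<open>i \<ge> 1\<close>, and the term \<open>i = 0\<close> is absent.\<close>
    obtain d j where d: "d \<in> {1..n}" "act P w (pth d j) \<noteq> 0"
      and k: "\<And>i. 1 \<le> i \<Longrightarrow> act P (act P w (pth d j)) (pth ((rot n ^^ j) d) i) = 0"
      using socle_exists[OF M w] by metis
    have "act P (act P w (pth a 0)) (pth d j) \<noteq> 0" using d(2) a(2) by simp
    then have "d = a" unfolding act_pth[OF M w(1) a(1) d(1)] by (simp split: if_splits)
    have "act P w (pth a j) = act P (g z) (pth a j)" using z by simp
    also have "\<dots> = (\<Sum>i<c. vscale (z i) (act P (act P w (pth a i)) (pth a j)))"
      unfolding g_def by (rule act_combination[OF M pth_closed[OF a(1)] cl])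
    also have "\<dots> = 0"
    proof (rule sum.neutral, rule ballI)
      fix i
      show "vscale (z i) (act P (act P w (pth a i)) (pth a j)) = 0"
      proof (cases "i = 0")
        case False
        have "act P w (pth a (j + i)) = 0"
          using k[of i] act_pth[OF M w(1) a(1) rot_vertex[OF a(1), of j], of j i] False \<open>d = a\<close> by simp
        then show ?thesis unfolding act_pth[OF M w(1) a(1) a(1)] by (simp add: add.commute)
      qed (use True in simp)
    qed
    finally show False using d \<open>d = a\<close> by simp
  qed
qed

text \<open>Superfluity of the kernel makes the cover of a uniserial module cyclic, and projectivity
  then forces its length to be \<open>plen a\<close>.\<close>

lemma syzygy_uniserial:
  assumes M: "right_module A M" and u: "uniserial M v a l" and l: "1 \<le> l"
    and cov: "projective_cover A P f M"
  shows "l \<le> plen a"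
    and "\<exists>w. uniserial (P\<lparr>space := ker_space P f\<rparr>) w ((rot n ^^ l) a) (plen a - l)"
    and "right_module A (P\<lparr>space := ker_space P f\<rparr>)"
proof -
  have a: "a \<in> {1..n}" and v: "v \<in> space M" "act M v (pth a 0) = v" "\<And>j. act M v (pth a j) = 0 \<longleftrightarrow> l \<le> j"
    and v_gen: "\<And>x. x \<in> space M \<Longrightarrow> \<exists>t. x = (\<Sum>j<l. vscale (t j) (act M v (pth a j)))"
    using u unfolding uniserial_def by blast+
  have P: "projective A P" and f: "is_hom A P M f" "f ` space P = space M"
    and sup: "\<And>U. submodule A P U \<Longrightarrow> {u + v |u v. u \<in> U \<and> v \<in> ker_space P f} = space P \<Longrightarrow> U = space P"
    using cov unfolding projective_cover_def is_epi_def by blast+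
  have PM: "right_module A P" using P by (simp add: projective_def)
  note sub = rm_subspace[OF PM]
  have f_act: "f (act P x (pth b i)) = act M (f x) (pth b i)" if "x \<in> space P" "b \<in> {1..n}" for x b i
    using f(1) that pth_closed unfolding is_hom_def by blast
  note lin = hom_linear[OF A.fd_algebra_axioms PM M f(1)]
  show ker: "right_module A (P\<lparr>space := ker_space P f\<rparr>)"
    by (intro rm_submodule[OF PM] ker_submodule[OF A.fd_algebra_axioms PM M f(1)])
  define c where "c = plen a"
  show lc: "l \<le> plen a" using v(3) act_pth_long[OF M v(1) a order.refl] by blast
  obtain w0 where w0: "w0 \<in> space P" "f w0 = v" using f(2) v(1) by (metis imageE)
  \<comment> \<open>Multiplying by the trivial path moves the preimage to the vertex
    \<open>a\<close> and keeps its image, because \<open>v\<close> already sits there.\<close>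
  define w where "w = act P w0 (pth a 0)"
  have w: "w \<in> space P" unfolding w_def by (intro rm_closed[OF PM w0(1)] pth_closed a)
  have we: "act P w (pth a 0) = w" unfolding w_def act_pth[OF PM w0(1) a a] by simp
  have fw: "f w = v" unfolding w_def using f_act[OF w0(1) a] w0(2) v(2) by simp
  define b where "b j = act P w (pth a j)" for j
  have b: "b j \<in> space P" "f (b j) = act M v (pth a j)" for j
    unfolding b_def using rm_closed[OF PM w pth_closed[OF a]] f_act[OF w a] fw by auto
  have b_long: "b j = 0" if "c \<le> j" for j
    unfolding b_def by (rule act_pth_long[OF PM w a]) (use that c_def in simp)
  \<comment> \<open>The submodule generated by \<open>w\<close>. It maps onto \<open>M\<close>, so
    that superfluity of the kernel makes it all of \<open>P\<close>.\<close>
  define U where "U = kvec.span (b ` {..<c})"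
  have comb: "(\<Sum>j<m. vscale (t j) (b j)) \<in> U" if "m \<le> c" for t m
    unfolding U_def by (intro kvec.span_sum kvec.span_scale kvec.span_base imageI) (use that in auto)
  have U_sub: "kvec.subspace U" unfolding U_def by simp
  have U_P: "U \<subseteq> space P" unfolding U_def by (rule kvec.span_minimal[OF _ sub]) (use b in auto)
  have U_elem: "\<exists>t. x = (\<Sum>j<c. vscale (t j) (b j))" if "x \<in> U" for x
  proof -
    have "x \<in> kvec.span (b ` {..<c})" using that by (simp add: U_def)
    then show ?thesis
    proof (induction rule: kvec.span_induct_alt)
      case base
      have "(\<Sum>j<c. vscale 0 (b j)) = 0" by simp
      from this[symmetric] show ?case by (rule exI[where x = "\<lambda>_. 0"])
    next
      case (step m x y)
      then obtain i t where i: "i < c" "x = b i" and t: "y = (\<Sum>j<c. vscale (t j) (b j))" by blast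
      have "(\<Sum>j<c. vscale ((if j = i then m else 0) + t j) (b j)) =
          (\<Sum>j<c. vscale (if j = i then m else 0) (b j)) + (\<Sum>j<c. vscale (t j) (b j))"
        by (simp only: kvec.scale_left_distrib sum.distrib)
      also have "(\<Sum>j<c. vscale (if j = i then m else 0) (b j)) = (\<Sum>j\<in>{i}. vscale (if j = i then m else 0) (b j))"
        by (rule sum.mono_neutral_right) (use i in auto)
      also have "\<dots> = vscale m (b i)" by simp
      finally have "vscale m x + y = (\<Sum>j<c. vscale ((if j = i then m else 0) + t j) (b j))"
        unfolding i(2) t by (rule sym)
      then show ?case by (rule exI[where x = "\<lambda>j. (if j = i then m else 0) + t j"])
    qed
  qed
  have "submodule A P U"
  proof (rule submoduleI_pth[OF PM U_P U_sub])
    fix x d i assume x: "x \<in> U" and d: "d \<in> {1..n}"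
    obtain t where t: "x = (\<Sum>j<c. vscale (t j) (b j))" using U_elem[OF x] by blast
    have eq: "act P x (pth d i) = (\<Sum>j<c. vscale (t j) (act P (b j) (pth d i)))"
      unfolding t by (rule act_combination[OF PM pth_closed[OF d] b(1)])
    have mem: "act P (b j) (pth d i) \<in> U" for j
    proof (cases "d = (rot n ^^ j) a \<and> j + i < c")
      case True
      then have "act P (b j) (pth d i) = b (j + i)"
        unfolding b_def using act_pth[OF PM w a d] by simp
      then show ?thesis unfolding U_def using True by (intro kvec.span_base) auto
    next
      case False
      then have "act P (b j) (pth d i) = 0"
        using act_pth[OF PM w a d, of j i] b_long[of "j + i"] unfolding b_def by auto
      then show ?thesis using kvec.subspace_0[OF U_sub] by metis
    qed
    show "act P x (pth d i) \<in> U"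
      unfolding eq by (intro kvec.subspace_sum[OF U_sub] kvec.subspace_scale[OF U_sub] mem)
  qed
  moreover have "{u + v |u v. u \<in> U \<and> v \<in> ker_space P f} = space P"
  proof (intro equalityI subsetI)
    fix x assume "x \<in> {u + v |u v. u \<in> U \<and> v \<in> ker_space P f}"
    then obtain u v where "x = u + v" "u \<in> space P" "v \<in> space P" using U_P unfolding ker_space_def by blast
    then show "x \<in> space P" using kvec.subspace_add[OF sub] by metis
  next
    fix x assume x: "x \<in> space P"
    then have "f x \<in> space M" using f(2) by (metis imageI)
    then obtain t where t: "f x = (\<Sum>j<l. vscale (t j) (act M v (pth a j)))" using v_gen by blast
    define y where "y = (\<Sum>j<l. vscale (t j) (b j))"
    have yU: "y \<in> U" unfolding y_def using comb lc c_def by blast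
    then have y: "y \<in> space P" "f y = f x"
      using U_P linear_on_sum[OF sub lin b(1)] unfolding t y_def b(2) by auto
    have m: "vscale (- 1) y \<in> space P" using kvec.subspace_scale[OF sub y(1)] .
    have "f (x + vscale (- 1) y) = f x + vscale (- 1) (f y)"
      using lin x y m unfolding linear_on_def by metis
    also have "\<dots> = 0" using y(2) by (auto simp: vscale_def fun_eq_iff)
    finally have "x + vscale (- 1) y \<in> ker_space P f"
      unfolding ker_space_def using kvec.subspace_add[OF sub x m] by blast
    moreover have "x = y + (x + vscale (- 1) y)" by (auto simp: vscale_def fun_eq_iff)
    ultimately show "x \<in> {u + v |u v. u \<in> U \<and> v \<in> ker_space P f}" using yU by blast
  qed
  ultimately have "U = space P" by (rule sup)
  then have gen: "\<exists>t. x = (\<Sum>j<c. vscale (t j) (b j))" if "x \<in> space P" for x using U_elem that by blast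
  have "v \<noteq> 0" using v(2) v(3)[of 0] l by auto
  then have "w \<noteq> 0" using fw linear_on_zero[OF sub lin] by auto
  then have b_last: "b (c - 1) \<noteq> 0"
    using projective_uniserial_nonzero[OF P w _ a we] gen unfolding b_def c_def by blast
  have b_zero: "b j = 0 \<longleftrightarrow> c \<le> j" for j
  proof
    assume "b j = 0"
    show "c \<le> j"
    proof (rule ccontr)
      assume "\<not> c \<le> j"
      then have "j \<le> c - 1" by simp
      with \<open>b j = 0\<close> have "b (c - 1) = 0" unfolding b_def by (rule act_pth_mono[OF PM w a])
      with b_last show False by contradiction
    qed
  qed (rule b_long)
  have shift: "act P (b l) (pth ((rot n ^^ l) a) j) = b (l + j)" for j
    unfolding b_def act_pth[OF PM w a rot_vertex[OF a]] by simp
  have "uniserial (P\<lparr>space := ker_space P f\<rparr>) (b l) ((rot n ^^ l) a) (c - l)"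
    unfolding uniserial_def
  proof (intro conjI ballI allI)
    show "(rot n ^^ l) a \<in> {1..n}" using a by (rule rot_vertex)
    have "f (b l) = 0" unfolding b(2) using v(3) by blast
    then show "b l \<in> space (P\<lparr>space := ker_space P f\<rparr>)" using b(1) by (simp add: ker_space_def)
    show "act (P\<lparr>space := ker_space P f\<rparr>) (b l) (pth ((rot n ^^ l) a) 0) = b l" using shift[of 0] by simp
    show "act (P\<lparr>space := ker_space P f\<rparr>) (b l) (pth ((rot n ^^ l) a) j) = 0 \<longleftrightarrow> c - l \<le> j" for j
      using shift[of j] b_zero[of "l + j"] by (simp add: le_diff_conv add.commute)
  next
    fix x assume "x \<in> space (P\<lparr>space := ker_space P f\<rparr>)"
    then have x: "x \<in> space P" "f x = 0" by (simp_all add: ker_space_def)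
    obtain t where t: "x = (\<Sum>j<c. vscale (t j) (b j))" using gen x(1) by blast
    have split: "(\<Sum>j<c. g j) = (\<Sum>j<l. g j) + (\<Sum>j<c - l. g (l + j))" for g :: "nat \<Rightarrow> nat \<Rightarrow> 'k"
      using lc sum.shift_bounds_nat_ivl[of g 0 l "c - l"] sum.atLeastLessThan_concat[of 0 l c g]
      by (simp add: c_def lessThan_atLeast0 add.commute)
    \<comment> \<open>\<open>f\<close> kills the terms with \<open>j \<ge> l\<close>, and the
      remaining ones are independent in \<open>M\<close>. So the first \<open>l\<close> coefficients
      of a kernel element vanish, and \<open>b l\<close> generates the kernel.\<close>
    have "0 = (\<Sum>j<c. vscale (t j) (act M v (pth a j)))"
      using x(2)[symmetric] unfolding t linear_on_sum[OF sub lin b(1)] b(2) .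
    also have "\<dots> = (\<Sum>j<l. vscale (t j) (act M v (pth a j)))"
      by (rule sum.mono_neutral_right) (use lc c_def v(3) in auto)
    finally have "t j = 0" if "j < l" for j
      by (intro uniserial_independent[OF M v(1) a v(3) _ that]) (rule sym)
    then have "(\<Sum>j<l. vscale (t j) (b j)) = 0" by (intro sum.neutral) simp
    then have "x = (\<Sum>j<c - l. vscale (t (l + j)) (b (l + j)))" unfolding t split by simp
    then show "\<exists>t. x = (\<Sum>j<c - l. vscale (t j) (act (P\<lparr>space := ker_space P f\<rparr>) (b l) (pth ((rot n ^^ l) a) j)))"
      using shift by (intro exI[of _ "\<lambda>j. t (l + j)"]) simp
  qed
  then show "\<exists>w. uniserial (P\<lparr>space := ker_space P f\<rparr>) w ((rot n ^^ l) a) (plen a - l)"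
    unfolding c_def by (rule exI[where x = "b l"])
qed

section \<open>The resolution map and injective envelopes\<close>

text \<open>The map \<open>f\<close> of the overview: the projective at \<open>x\<close> is the
  interval \<open>[x, res x)\<close>.\<close>

definition res :: "int \<Rightarrow> int" where
  "res x = x + int (plen (vert n x))"

lemma res_gt: "x < res x"
  using plen_pos[OF vert_in[OF n1]] by (simp add: res_def less_eq_Suc_le)

lemma res_mono: "x \<le> y \<Longrightarrow> res x \<le> res y"
proof (induction y rule: int_ge_induct)
  case (step y)
  have "plen (vert n y) \<le> plen (vert n (y + 1)) + 1"
    using plen_rot[OF vert_in[OF n1], of y] rot_vert[OF n1] by simp
  then have "res y \<le> res (y + 1)" by (simp add: res_def)
  with step show ?case by simp
qed simp

lemma res_shift: "res (x + k * int n) = res x + k * int n"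
proof -
  have "vert n (x + k * int n) = vert n x" using vert_eq_iff[OF n1] by blast
  then show ?thesis by (simp add: res_def)
qed

section \<open>Paths into a vertex and the adjoint of \<open>res\<close>\<close>

text \<open>A path of length \<open>i\<close> ending at \<open>b\<close> is nonzero exactly if
  \<open>b < res (b - i)\<close>; by monotonicity of \<open>res\<close> this is therefore the number
  of nonzero paths into \<open>b\<close>.\<close>

definition colen :: "nat \<Rightarrow> nat" where
  "colen b = (LEAST i. res (int b - int i) \<le> int b)"

lemma colen_le_iff: "res (int b - int i) \<le> int b \<longleftrightarrow> colen b \<le> i"
proof
  assume "res (int b - int i) \<le> int b"
  then show "colen b \<le> i" unfolding colen_def by (rule Least_le)
next
  \<comment> \<open>The largest \<open>plen\<close> provides one \<open>i\<close> that satisfies the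
    condition, so the minimum exists; monotonicity of \<open>res\<close> passes the condition on to
    all larger \<open>i\<close>.\<close>
  define C where "C = Max (plen ` {1..n})"
  have "plen (vert n x) \<le> C" for x
    unfolding C_def using vert_in[OF n1] by (intro Max_ge) auto
  then have "res (int b - int C) \<le> int b" unfolding res_def by (simp add: add.commute)
  then have least: "res (int b - int (colen b)) \<le> int b" unfolding colen_def by (rule LeastI)
  assume "colen b \<le> i"
  then have "res (int b - int i) \<le> res (int b - int (colen b))" by (intro res_mono) simp
  with least show "res (int b - int i) \<le> int b" by simp
qed

lemma colen_pos: "1 \<le> colen b"
  using colen_le_iff[of b 0] res_gt[of "int b"] by simp

text \<open>The map \<open>g\<close> of the overview, with a path count in place of the dimension of
  the injective until the two are identified.\<close>

definition cores :: "int \<Rightarrow> int" where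
  "cores y = y - int (colen (vert n y))"

text \<open>A common shift by a multiple of \<open>n\<close> moves \<open>y\<close> to its vertex
  \<open>b\<close>. There the claim is \<open>colen_le_iff\<close> with \<open>i = b - x'\<close>;
  for \<open>x' > b\<close> both sides fail.\<close>

lemma res_cores_adjoint: "res x \<le> y \<longleftrightarrow> x \<le> cores y"
proof -
  define b where "b = vert n y"
  have "vert n y = vert n (int b)" using vert_int[OF vert_in[OF n1]] by (simp add: b_def)
  then obtain k where k: "y = int b + k * int n" using vert_eq_iff[OF n1] by blast
  define x' where "x' = x - k * int n"
  have x: "x = x' + k * int n" by (simp add: x'_def)
  have "res x \<le> y \<longleftrightarrow> res x' \<le> int b" unfolding x k res_shift by simp
  also have "\<dots> \<longleftrightarrow> x' \<le> int b - int (colen b)"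
  proof (cases "x' \<le> int b")
    case True
    then have "x' = int b - int (nat (int b - x'))" by simp
    then have "res x' \<le> int b \<longleftrightarrow> colen b \<le> nat (int b - x')"
      using colen_le_iff[of b "nat (int b - x')"] by simp
    then show ?thesis using True by linarith
  next
    case False
    then show ?thesis using res_gt[of x'] by linarith
  qed
  also have "\<dots> \<longleftrightarrow> x \<le> y - int (colen b)" unfolding x k by linarith
  also have "y - int (colen b) = cores y" by (simp add: cores_def b_def)
  finally show ?thesis .
qed

lemma cores_shift: "cores (y + k * int n) = cores y + k * int n"
proof -
  have "vert n (y + k * int n) = vert n y" using vert_eq_iff[OF n1] by blast
  then show ?thesis by (simp add: cores_def)
qed

section \<open>The dimension of the injective envelope\<close>

lemma path_into:
  assumes b: "b \<in> {1..n}" and c: "c \<in> {1..n}" and j: "(rot n ^^ j) c = b"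
  shows "c = vert n (int b - int j)" and "j < plen c \<Longrightarrow> j < colen b"
proof -
  have "vert n (int c + int j) = vert n (int b)"
    using rot_pow_vert[OF n1, of j "int c"] vert_int[OF b] vert_int[OF c] j by simp
  then obtain k where "int c + int j = int b + k * int n" using vert_eq_iff[OF n1] by blast
  then have "int c = (int b - int j) + k * int n" by simp
  then have "vert n (int c) = vert n (int b - int j)" using vert_eq_iff[OF n1] by blast
  then show c': "c = vert n (int b - int j)" using vert_int[OF c] by simp
  assume "j < plen c"
  then have "int b < res (int b - int j)" unfolding res_def c'[symmetric] by simp
  then show "j < colen b" using colen_le_iff[of b j] by simp
qed

text \<open>A linear form nonzero on \<open>s\<close>, here the coordinate \<open>i0\<close>, embeds
  \<open>E\<close> into \<open>colen b\<close> coordinates: \<open>x\<close> goes to the values of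
  the form on \<open>x\<close> times the paths into \<open>b\<close>, one for each length. A nonzero
  \<open>x\<close> has a path multiple that is a socle vector; by essentiality it is a nonzero
  multiple of \<open>s\<close>, so the path ends at \<open>b\<close> and the form detects
  it.\<close>

lemma essential_extension_mdim_le:
  assumes b: "b \<in> {1..n}" and E: "right_module A E"
    and s: "s \<in> space E" "s \<noteq> 0" "act E s (pth b 0) = s"
    and ess: "\<And>U. submodule A E U \<Longrightarrow> U \<inter> kvec.span {s} = {0} \<Longrightarrow> U = {0}"
  shows "mdim E \<le> colen b"
proof -
  obtain i0 where i0: "s i0 \<noteq> 0" using s(2) by (auto simp: fun_eq_iff)
  define q where "q = colen b"
  define T where "T x = (\<lambda>j. if j < q then act E x (pth (vert n (int b - int j)) j) i0 else 0)" for x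
  have vc: "vert n x \<in> {1..n}" for x by (rule vert_in[OF n1])
  have lin: "linear_on (space E) T"
    unfolding linear_on_def T_def
    by (auto simp: fun_eq_iff rm_add[OF E _ _ pth_closed[OF vc]] rm_smult[OF E _ pth_closed[OF vc]] vscale_apply)
  have inj: "x = 0" if x: "x \<in> space E" "T x = 0" for x
  proof (rule ccontr)
    assume "x \<noteq> 0"
    then obtain c j where c: "c \<in> {1..n}" "j < plen c" "act E x (pth c j) \<noteq> 0"
      and k: "\<And>i. 1 \<le> i \<Longrightarrow> act E (act E x (pth c j)) (pth ((rot n ^^ j) c) i) = 0"
      using socle_exists[OF E x(1)] by metis
    define z where "z = act E x (pth c j)"
    define e where "e = (rot n ^^ j) c"
    have e: "e \<in> {1..n}" unfolding e_def using c(1) by (rule rot_vertex)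
    have z: "z \<in> space E" unfolding z_def by (intro rm_closed[OF E x(1)] pth_closed c)
    have ze: "act E z (pth e 0) = z" unfolding z_def e_def using act_pth[OF E x(1) c(1) rot_vertex[OF c(1), of j]] by simp
    have k': "act E z (pth e i) = 0" if "1 \<le> i" for i using k[OF that] by (simp add: z_def e_def)
    have "z \<in> kvec.span {z}" by (simp add: kvec.span_base)
    then have "kvec.span {z} \<noteq> {0}" using c(3) unfolding z_def by blast
    then have "kvec.span {z} \<inter> kvec.span {s} \<noteq> {0}" using ess[OF span_submodule[OF E z e ze k']] by blast
    moreover have "0 \<in> kvec.span {z} \<inter> kvec.span {s}" by (simp add: kvec.span_zero)
    ultimately obtain y where y: "y \<in> kvec.span {z}" "y \<in> kvec.span {s}" "y \<noteq> 0" by blast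
    obtain m where m: "y = vscale m z" using y(1) span_singletonE by metis
    obtain m' where m': "y = vscale m' s" using y(2) span_singletonE by metis
    have m0: "m' \<noteq> 0" "m \<noteq> 0" using y(3) m m' by auto
    have "act E y (pth b 0) = y" unfolding m' rm_smult[OF E s(1) pth_closed[OF b]] s(3) ..
    then have "act E z (pth b 0) \<noteq> 0" using y(3) unfolding m rm_smult[OF E z pth_closed[OF b]] by auto
    then have "e = b" using act_pth[OF E z e b, of 0 0] ze by (simp split: if_splits)
    then have cb: "c = vert n (int b - int j)" "j < q"
      using path_into[OF b c(1), of j] c(2) by (simp_all add: e_def q_def)
    then have "T x j = z i0" by (simp add: T_def z_def)
    then have "z i0 = 0" using x(2) by simp
    moreover have "m * z i0 = m' * s i0" using m m' by (metis vscale_def)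
    ultimately show False using m0 i0 by simp
  qed
  obtain C where C: "finite C" "space E \<subseteq> kvec.span C" using rm_finite[OF E] by blast
  have "kvec.dim (space E) \<le> kvec.dim (kvec.span (unit_seq ` {..<q} :: (nat \<Rightarrow> 'k) set))"
  proof (rule dim_le_linear_inj[OF rm_subspace[OF E] C lin inj])
    show "T ` space E \<subseteq> kvec.span (unit_seq ` {..<q})" unfolding supported_span by (auto simp: T_def)
    show "finite (unit_seq ` {..<q} :: (nat \<Rightarrow> 'k) set)" by simp
  qed simp_all
  also have "\<dots> \<le> card (unit_seq ` {..<q} :: (nat \<Rightarrow> 'k) set)" by (rule kvec.dim_le_card) simp_all
  also have "\<dots> \<le> q" using card_image_le[of "{..<q}"] by simp
  finally show ?thesis by (simp add: mdim_def q_def)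
qed

text \<open>The longest nonzero path into \<open>b\<close> has length \<open>colen b - 1\<close> and
  starts at \<open>x\<close>; the module \<open>seg x l\<close> has its socle at \<open>b\<close>.
  Injectivity extends the map sending this socle to \<open>s\<close>, and the extension is injective
  because each nonzero vector has a nonzero path multiple in the socle.\<close>

lemma injective_extension_mdim_ge:
  assumes b: "b \<in> {1..n}" and inj: "injective A E"
    and s: "s \<in> space E" "s \<noteq> 0" "\<And>i. act E s (pth b i) = (if i = 0 then s else 0)"
  shows "colen b \<le> mdim E"
proof -
  define l where "l = colen b"
  define x where "x = vert n (int b - int (l - 1))"
  have l: "1 \<le> l" using colen_pos by (simp add: l_def)
  have x: "x \<in> {1..n}" unfolding x_def by (rule vert_in[OF n1])
  have E: "right_module A E" using inj by (simp add: injective_def)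
  have rx: "(rot n ^^ i) x = vert n (int b - int (l - 1) + int i)" for i
    unfolding x_def by (rule rot_pow_vert[OF n1])
  have rb: "(rot n ^^ (l - 1)) x = b" unfolding rx using vert_int[OF b] by simp
  have lp: "l \<le> plen x"
  proof -
    have "\<not> colen b \<le> l - 1" using l by (simp add: l_def)
    then have "int b < res (int b - int (l - 1))" using colen_le_iff[of b "l - 1"] by simp
    then show ?thesis unfolding res_def x_def[symmetric] by simp
  qed
  let ?M = "seg x l" and ?N = "seg b 1"
  have M: "right_module A ?M" by (rule seg_right_module[OF x lp])
  have N: "right_module A ?N" by (rule seg_right_module[OF b plen_pos[OF b]])
  have Nact: "act ?N v (pth c i) = (\<lambda>m. if m = 0 \<and> i = 0 \<and> c = b then v 0 else 0)" if "c \<in> {1..n}" for v c i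
    unfolding seg_pth[OF b plen_pos[OF b] that] by (auto simp: fun_eq_iff)
  \<comment> \<open>The last coordinate of \<open>seg x l\<close> is its socle.\<close>
  define g where "g v = (\<lambda>i. if i = l - 1 then v 0 else (0::'k))" for v :: "nat \<Rightarrow> 'k"
  define \<theta> where "\<theta> v = vscale (v 0) s" for v :: "nat \<Rightarrow> 'k"
  have "is_hom A ?N ?M g"
  proof (rule is_homI_pth[OF N M])
    show "linear_on (space ?N) g" unfolding linear_on_def g_def by (auto simp: fun_eq_iff vscale_def)
    show "g v \<in> space ?M" if "v \<in> space ?N" for v using l by (auto simp: g_def seg_space)
    show "g (act ?N v (pth c i)) = act ?M (g v) (pth c i)" if c: "c \<in> {1..n}" for v c i
    proof
      fix m
      have "m - i = l - 1 \<and> m < l \<and> i \<le> m \<longleftrightarrow> m = l - 1 \<and> i = 0" using l by auto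
      then show "g (act ?N v (pth c i)) m = act ?M (g v) (pth c i) m"
        unfolding Nact[OF c] seg_pth[OF x lp c] g_def using rb by auto
    qed
  qed
  moreover have "inj_on g (space ?N)"
  proof (rule inj_onI)
    fix v w assume v: "v \<in> space ?N" "w \<in> space ?N" "g v = g w"
    then have "g v (l - 1) = g w (l - 1)" by simp
    then have "v 0 = w 0" by (simp add: g_def)
    moreover have "v i = 0" "w i = 0" if "1 \<le> i" for i using v that by (simp_all add: seg_space)
    ultimately have "v i = w i" for i by (cases "i = 0") auto
    then show "v = w" by blast
  qed
  ultimately have mono: "is_mono A ?N ?M g" by (simp add: is_mono_def)
  have "is_hom A ?N E \<theta>"
  proof (rule is_homI_pth[OF N E])
    show "linear_on (space ?N) \<theta>" unfolding linear_on_def \<theta>_def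
      by (auto simp: fun_eq_iff vscale_def algebra_simps)
    show "\<theta> v \<in> space E" for v unfolding \<theta>_def by (rule kvec.subspace_scale[OF rm_subspace[OF E] s(1)])
    show "\<theta> (act ?N v (pth c i)) = act E (\<theta> v) (pth c i)" if c: "c \<in> {1..n}" for v c i
    proof -
      have "act E s (pth c i) = (if c = b \<and> i = 0 then s else 0)"
        using act_pth[OF E s(1) b c, of 0 i] s(3)[of 0] s(3)[of i] by (auto split: if_splits)
      then show ?thesis
        unfolding \<theta>_def rm_smult[OF E s(1) pth_closed[OF c]] Nact[OF c] by simp
    qed
  qed
  then obtain h where h: "is_hom A ?M E h" "\<And>v. v \<in> space ?N \<Longrightarrow> h (g v) = \<theta> v"
    using inj mono M N unfolding injective_def by blast
  note lin = hom_linear[OF A.fd_algebra_axioms M E h(1)]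
  have "unit_seq 0 \<in> space ?N" by (simp add: seg_space unit_seq_def)
  moreover have "g (unit_seq 0) = unit_seq (l - 1)" by (auto simp: g_def unit_seq_def fun_eq_iff)
  ultimately have hs: "h (unit_seq (l - 1)) = s" using h(2)[of "unit_seq 0"] by (simp add: \<theta>_def unit_seq_def)
  have inj_h: "v = 0" if v: "v \<in> space ?M" "h v = 0" for v
  proof (rule ccontr)
    assume "v \<noteq> 0"
    then have ex: "\<exists>i. v i \<noteq> 0" by (auto simp: fun_eq_iff)
    define i where "i = (LEAST i. v i \<noteq> 0)"
    have i: "v i \<noteq> 0" "\<And>j. j < i \<Longrightarrow> v j = 0"
      unfolding i_def using LeastI_ex[OF ex] not_less_Least by blast+
    have il: "i < l" using i(1) v(1) by (auto simp: seg_space not_less[symmetric])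
    let ?c = "(rot n ^^ i) x"
    have c: "?c \<in> {1..n}" using x by (rule rot_vertex)
    \<comment> \<open>The path carries the first nonzero coordinate \<open>i\<close> to the last
      place and pushes all later ones beyond the end.\<close>
    have "act ?M v (pth ?c (l - 1 - i)) = vscale (v i) (unit_seq (l - 1))"
    proof
      fix m
      have "v (m - (l - 1 - i)) = 0" if "m \<noteq> l - 1" "m < l" "l - 1 - i \<le> m"
        by (rule i(2)) (use that il in linarith)
      then show "act ?M v (pth ?c (l - 1 - i)) m = vscale (v i) (unit_seq (l - 1)) m"
        unfolding seg_pth[OF x lp c] vscale_def unit_seq_def using il by auto
    qed
    moreover have "unit_seq (l - 1) \<in> space ?M" using l by (auto simp: seg_space unit_seq_def)
    ultimately have "h (act ?M v (pth ?c (l - 1 - i))) = vscale (v i) s"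
      using lin hs unfolding linear_on_def by metis
    moreover have "h (act ?M v (pth ?c (l - 1 - i))) = act E (h v) (pth ?c (l - 1 - i))"
      using h(1) v(1) pth_closed[OF c] unfolding is_hom_def by blast
    ultimately have "vscale (v i) s = 0" using v(2) rm_zero[OF E pth_closed[OF c]] by metis
    then show False using i(1) s(2) by (simp add: kvec.scale_eq_0_iff)
  qed
  obtain C where C: "finite C" "space ?M \<subseteq> kvec.span C" using rm_finite[OF M] by blast
  obtain D where D: "finite D" "space E \<subseteq> kvec.span D" using rm_finite[OF E] by blast
  have "h ` space ?M \<subseteq> space E" using h(1) unfolding is_hom_def by blast
  from dim_le_linear_inj[OF rm_subspace[OF M] C lin inj_h this D]
  have "mdim ?M \<le> mdim E" by (simp add: mdim_def)
  then show ?thesis using mdim_uniserial[OF M seg_uniserial[OF x l lp]] by (simp add: l_def)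
qed

text \<open>The image of the simple module is a line spanned by a vector at \<open>b\<close>, the
  common starting point of the two bounds.\<close>

lemma injective_envelope_mdim:
  assumes b: "b \<in> {1..n}" and S: "simple_at A (vertex_idem n \<rho> \<phi> b) S" and E: "injective_envelope A E \<iota> S"
  shows "mdim E = colen b"
proof -
  have inj: "injective A E" and \<iota>: "is_hom A S E \<iota>" "inj_on \<iota> (space S)"
    and ess: "\<And>U. submodule A E U \<Longrightarrow> U \<inter> \<iota> ` space S = {0} \<Longrightarrow> U = {0}"
    using E unfolding injective_envelope_def is_mono_def by blast+
  have SM: "right_module A S" using S by (simp add: simple_at_def simple_module_def)
  have EM: "right_module A E" using inj by (simp add: injective_def)
  note lin = hom_linear[OF A.fd_algebra_axioms SM EM \<iota>(1)]
  note 0 = linear_on_zero[OF rm_subspace[OF SM] lin]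
  obtain t where t: "uniserial S t b 1" using simple_at_uniserial[OF b S] by blast
  then have t1: "t \<in> space S" "act S t (pth b 0) = t" "\<And>j. act S t (pth b j) = 0 \<longleftrightarrow> 1 \<le> j"
    unfolding uniserial_def by blast+
  have "t \<noteq> 0" using t1(2) t1(3)[of 0] by auto
  define s where "s = \<iota> t"
  have s: "s \<in> space E" "s \<noteq> 0"
    using \<iota> t1(1) \<open>t \<noteq> 0\<close> 0 kvec.subspace_0[OF rm_subspace[OF SM]] unfolding s_def is_hom_def inj_on_def by metis+
  have "act E s (pth b i) = \<iota> (act S t (pth b i))" for i
    using \<iota>(1) t1(1) pth_closed[OF b] unfolding s_def is_hom_def by metis
  then have sp: "act E s (pth b i) = (if i = 0 then s else 0)" for i
    using t1(2) t1(3)[of i] 0 by (cases "i = 0") (simp_all add: s_def)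
  have img: "\<iota> ` space S = kvec.span {s}"
  proof (intro equalityI subsetI)
    fix y assume "y \<in> \<iota> ` space S"
    then obtain x where x: "x \<in> space S" "y = \<iota> x" by blast
    then obtain m where "x = (\<Sum>j<1. vscale (m j) (act S t (pth b j)))" using t unfolding uniserial_def by blast
    then have "x = vscale (m 0) t" using t1(2) by simp
    then have "y = vscale (m 0) s" using x(2) lin t1(1) unfolding linear_on_def s_def by metis
    then show "y \<in> kvec.span {s}" by (simp add: kvec.span_base kvec.span_scale)
  next
    fix y assume "y \<in> kvec.span {s}"
    then obtain m where "y = vscale m s" using span_singletonE by metis
    then have "y = \<iota> (vscale m t)" using lin t1(1) unfolding linear_on_def s_def by metis
    moreover have "vscale m t \<in> space S" using kvec.subspace_scale[OF rm_subspace[OF SM] t1(1)] .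
    ultimately show "y \<in> \<iota> ` space S" by blast
  qed
  have "act E s (pth b 0) = s" using sp[of 0] by simp
  then have "mdim E \<le> colen b"
    using essential_extension_mdim_le[OF b EM s] ess unfolding img by blast
  then show ?thesis using injective_extension_mdim_ge[OF b inj s sp] by simp
qed

end

section \<open>Resolutions of simple modules\<close>

text \<open>The cover of a zero module is zero: its kernel is everything, and superfluity forces
  \<open>{0}\<close> to be the whole cover. So the resolution stops for good at the first zero
  syzygy. Contrapositively, infinite projective dimension keeps all syzygies nonzero.\<close>

lemma zero_syzygy_proj_dim:
  assumes res: "minimal_projective_resolution A M P d" and zero: "space (syzygy M P d j) = {0}"
  shows "proj_dim A M \<le> enat j"
proof -
  have cov: "projective_cover A (P i) (d i) (syzygy M P d i)" for i
    using res by (simp add: minimal_projective_resolution_def)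
  have P0: "space (P i) = {0}" if "space (syzygy M P d i) = {0}" for i
  proof -
    have PM: "right_module A (P i)" and im: "d i ` space (P i) = space (syzygy M P d i)"
      and sup: "\<And>U. submodule A (P i) U \<Longrightarrow> {u + v |u v. u \<in> U \<and> v \<in> ker_space (P i) (d i)} = space (P i) \<Longrightarrow> U = space (P i)"
      using cov[of i] unfolding projective_cover_def projective_def is_epi_def by blast+
    have sub: "submodule A (P i) {0}"
      using kvec.subspace_0[OF rm_subspace[OF PM]] rm_zero[OF PM] by (simp add: submodule_def kvec.subspace_def)
    have "ker_space (P i) (d i) = space (P i)" using im that unfolding ker_space_def by blast
    then have "{u + v |u v. u \<in> {0} \<and> v \<in> ker_space (P i) (d i)} = space (P i)" by simp
    from sup[OF sub this] show ?thesis by (rule sym)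
  qed
  have syz0: "space (syzygy M P d i) = {0}" if "j \<le> i" for i
    using that
  proof (induction i rule: dec_induct)
    case (step i)
    have "ker_space (P i) (d i) \<subseteq> {0}" unfolding ker_space_def using P0[OF step(3)] by blast
    \<comment> \<open>The next map of the resolution is onto this syzygy, which is thus
      nonempty.\<close>
    moreover have "0 \<in> space (syzygy M P d (Suc i))"
    proof -
      have "d (Suc i) ` space (P (Suc i)) = space (syzygy M P d (Suc i))" "right_module A (P (Suc i))"
        using cov[of "Suc i"] unfolding projective_cover_def projective_def is_epi_def by blast+
      then have "space (syzygy M P d (Suc i)) \<noteq> {}"
        using kvec.subspace_0[OF rm_subspace] by blast
      then show ?thesis using \<open>ker_space (P i) (d i) \<subseteq> {0}\<close> by auto
    qed
    moreover have "space (syzygy M P d (Suc i)) = ker_space (P i) (d i)" by simp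
    ultimately show ?case by blast
  qed (rule zero)
  have "projective_resolution A M P d"
    using res cov unfolding projective_resolution_def minimal_projective_resolution_def projective_cover_def by blast
  moreover have "\<forall>i>j. space (P i) = {0}" using P0 syz0 by simp
  ultimately show ?thesis unfolding proj_dim_def by (intro Inf_lower) blast
qed

context nakayama
begin

text \<open>\<open>M\<close> is the uniserial module whose composition factors, from the top, sit at the vertices
  \<open>x, \<dots>, y - 1\<close> modulo \<open>n\<close>; taking syzygies sends \<open>[x, y)\<close> to \<open>[y, res x)\<close>.\<close>

definition interval_module :: "('a, 'k) rmodule \<Rightarrow> int \<Rightarrow> int \<Rightarrow> bool" where
  "interval_module M x y \<longleftrightarrow> right_module A M \<and> x < y \<and> (\<exists>v. uniserial M v (vert n x) (nat (y - x)))"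

lemma interval_module_mdim: "interval_module M x y \<Longrightarrow> mdim M = nat (y - x)"
  using mdim_uniserial unfolding interval_module_def by blast

text \<open>\<open>[x, y)\<close> is a quotient of the projective \<open>[x, res x)\<close>, and the
  kernel is the remaining tail; \<open>nz\<close> says that this tail is not empty.\<close>

lemma interval_module_syzygy:
  assumes M: "interval_module M x y" and cov: "projective_cover A P f M" and nz: "ker_space P f \<noteq> {0}"
  shows "interval_module (P\<lparr>space := ker_space P f\<rparr>) y (res x)"
proof -
  obtain v where v: "right_module A M" "x < y" "uniserial M v (vert n x) (nat (y - x))"
    using M unfolding interval_module_def by blast
  have l: "1 \<le> nat (y - x)" using v(2) by simp
  note syz = syzygy_uniserial[OF v(1,3) l cov]
  obtain w where w: "uniserial (P\<lparr>space := ker_space P f\<rparr>) w ((rot n ^^ nat (y - x)) (vert n x)) (plen (vert n x) - nat (y - x))"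
    using syz(2) by blast
  have "(rot n ^^ nat (y - x)) (vert n x) = vert n y"
    using rot_pow_vert[OF n1, of "nat (y - x)" x] v(2) by simp
  moreover have len: "plen (vert n x) - nat (y - x) = nat (res x - y)"
    using v(2) syz(1) unfolding res_def by linarith
  ultimately have w': "uniserial (P\<lparr>space := ker_space P f\<rparr>) w (vert n y) (nat (res x - y))"
    using w by simp
  have "y < res x"
  proof (rule ccontr)
    assume "\<not> y < res x"
    then have 0: "nat (res x - y) = 0" by simp
    have "u = 0" if "u \<in> ker_space P f" for u
      using w' that unfolding 0 uniserial_def by auto
    moreover have "0 \<in> ker_space P f" using kvec.subspace_0[OF rm_subspace[OF syz(3)]] by simp
    ultimately show False using nz by blast
  qed
  then show ?thesis using syz(3) w' unfolding interval_module_def by blast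
qed

text \<open>Two syzygies send \<open>[x, y)\<close> through \<open>[y, res x)\<close> to
  \<open>[res x, res y)\<close>, and the simple module at \<open>a\<close> is
  \<open>[a, a + 1)\<close>.\<close>

lemma interval_module_syzygies:
  assumes a: "a \<in> {1..n}" and S: "simple_at A (vertex_idem n \<rho> \<phi> a) S"
    and min: "minimal_projective_resolution A S P d"
    and nz: "\<And>j. space (syzygy S P d j) \<noteq> {0}"
  shows "interval_module (syzygy S P d (2 * i)) ((res ^^ i) (int a)) ((res ^^ i) (int a + 1))"
proof (induction i)
  case 0
  have "right_module A S" using min by (simp add: minimal_projective_resolution_def)
  then show ?case using simple_at_uniserial[OF a S] vert_int[OF a] by (simp add: interval_module_def)
next
  case (Suc i)
  have cov: "projective_cover A (P j) (d j) (syzygy S P d j)" for j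
    using min by (simp add: minimal_projective_resolution_def)
  have ker: "ker_space (P j) (d j) \<noteq> {0}" for j using nz[of "Suc j"] by simp
  have "interval_module (syzygy S P d (Suc (2 * i))) ((res ^^ i) (int a + 1)) (res ((res ^^ i) (int a)))"
    using interval_module_syzygy[OF Suc cov ker] by simp
  from interval_module_syzygy[OF this cov ker]
  show ?case by simp
qed

end

theorem theorem3p7:
  fixes A :: "('k::field, 'a) module"
    and \<rho> :: "(nat \<times> nat) set"
    and \<phi> :: "(nat \<times> nat \<Rightarrow> 'k) set \<Rightarrow> 'a"
    and S I P :: "nat \<Rightarrow> ('a, 'k) rmodule"
    and \<iota> d :: "nat \<Rightarrow> (nat \<Rightarrow> 'k) \<Rightarrow> (nat \<Rightarrow> 'k)"
    and q :: "nat \<Rightarrow> nat"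
    and n a r p :: nat
  assumes "nakayama_algebra n \<rho> \<phi> A"
    and "\<And>b. b \<in> {1..n} \<Longrightarrow> simple_at A (vertex_idem n \<rho> \<phi> b) (S b)"
    and "\<And>b. b \<in> {1..n} \<Longrightarrow> injective_envelope A (I b) (\<iota> b) (S b)"
    and "\<And>b. b \<in> {1..n} \<Longrightarrow> q b = mdim (I b)"
    and "a \<in> {1..n}"
    and "proj_dim A (S a) = \<infinity>"
    and "minimal_projective_resolution A (S a) P d"
    and "periodic_after A (syzygy (S a) P d) (2 * r)"
    and "is_periodicity (coresolution_arrows n q) p"
  shows "(\<Sum>i<p. mdim (syzygy (S a) P d (2 * r + 2 * i)))
           = card (component (coresolution_arrows n q) a)"
proof -
  interpret nakayama n \<rho> \<phi> A by unfold_locales (rule assms(1))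
  let ?V = "{1..n}" and ?\<Omega> = "syzygy (S a) P d"
  define \<psi> where "\<psi> = coresolution_map n q"
  have q: "q b = colen b" if "b \<in> ?V" for b
    using assms(4)[OF that] injective_envelope_mdim[OF that assms(2)[OF that] assms(3)[OF that]] by simp
  have lift: "vert n (cores y) = \<psi> (vert n y)" for y
    unfolding \<psi>_def coresolution_map_def cores_def q[OF vert_in[OF n1]] inv_rot_pow_vert[OF n1] ..
  interpret lift: adjoint_lift n res cores \<psi>
    by unfold_locales (rule n1 res_cores_adjoint cores_shift lift)+
  have \<psi>V: "\<psi> ` ?V \<subseteq> ?V"
    using lift[of "int _"] vert_in[OF n1] vert_int by (metis image_subsetI)
  have arrows: "coresolution_arrows n q = {(a, \<psi> a) |a. a \<in> ?V}"
    by (simp add: coresolution_arrows_def \<psi>_def)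
  have nz: "space (?\<Omega> j) \<noteq> {0}" for j
    using zero_syzygy_proj_dim[OF assms(7), of j] assms(6) by auto
  note int = interval_module_syzygies[OF assms(5) assms(2)[OF assms(5)] assms(7) nz]
  have dim: "mdim (?\<Omega> (2 * i)) = card {y \<in> ?V. (\<psi> ^^ i) y = a}" for i
    using interval_module_mdim[OF int] lift.card_fibre[OF assms(5)] by simp
  have ne: "{y \<in> ?V. (\<psi> ^^ i) y = a} \<noteq> {}" for i
  proof -
    have "0 < mdim (?\<Omega> (2 * i))"
      using interval_module_mdim[OF int[of i]] int[of i] by (simp add: interval_module_def)
    then show ?thesis unfolding dim by (metis card.empty less_numeral_extra(3))
  qed
  then obtain m where m: "1 \<le> m" "(\<psi> ^^ m) a = a"
    using periodic_if_fibres_nonempty[OF _ \<psi>V] by blast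
  obtain b where b: "(b, b) \<in> (coresolution_arrows n q)\<^sup>+"
    and p: "p = card {c. (b, c) \<in> (coresolution_arrows n q)\<^sup>+}"
    using assms(9) by (auto simp: is_periodicity_def is_cycle_def)
  have bV: "b \<in> ?V" and bper: "\<exists>k\<ge>1. (\<psi> ^^ k) b = b"
    using b unfolding arrows funpow_arrows_trancl[OF \<psi>V] by metis+
  define k where "k = (LEAST k. 1 \<le> k \<and> (\<psi> ^^ k) b = b)"
  have k: "1 \<le> k" "(\<psi> ^^ k) b = b" and kmin: "\<And>i. 0 < i \<Longrightarrow> i < k \<Longrightarrow> (\<psi> ^^ i) b \<noteq> b"
    using LeastI_ex[OF bper] not_less_Least[of _ "\<lambda>k. 1 \<le> k \<and> (\<psi> ^^ k) b = b"] unfolding k_def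
    by (blast, blast, metis One_nat_def Suc_leI)
  have "p = k"
    unfolding p arrows funpow_arrows_trancl[OF \<psi>V] using card_orbit_period[OF k(2,1) kmin] bV by simp
  then have pb: "1 \<le> p" "(\<psi> ^^ p) b = b" "\<And>i. 0 < i \<Longrightarrow> i < p \<Longrightarrow> (\<psi> ^^ i) b \<noteq> b"
    using k kmin by blast+
  \<comment> \<open>The cycle that defines \<open>p\<close> passes through some \<open>b\<close>,
    possibly far from \<open>a\<close>. Uniqueness of periods is applied in both directions:
    \<open>p\<close> is a period of \<open>a\<close>, and a smaller period of \<open>a\<close> would
    be one of \<open>b\<close>.\<close>
  have pa: "(\<psi> ^^ p) a = a"
    by (rule lift.period_unique[OF bV pb(2) assms(5) m(2,1)])
  have pa_min: "(\<psi> ^^ i) a \<noteq> a" if "0 < i" "i < p" for i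
    using lift.period_unique[OF assms(5) _ bV pb(2,1), of i] pb(3)[OF that] by blast
  obtain s where s: "1 \<le> s" "\<And>i. 2 * r \<le> i \<Longrightarrow> module_iso A (?\<Omega> (i + s)) (?\<Omega> i)"
    using assms(8) by (auto simp: periodic_after_def)
  \<comment> \<open>The interval description covers the even syzygies; an odd one is the kernel of a
    cover of an even one.\<close>
  have rm: "right_module A (?\<Omega> i)" for i
  proof (cases i)
    case 0 then show ?thesis using assms(7) by (simp add: minimal_projective_resolution_def)
  next
    case (Suc j)
    show ?thesis
    proof (cases "even i")
      case True then show ?thesis using int by (auto simp: interval_module_def elim!: evenE)
    next
      case False
      then obtain k where "j = 2 * k" using Suc by (auto elim: evenE)
      then have M: "right_module A (?\<Omega> j)" using int by (auto simp: interval_module_def)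
      have "projective_cover A (P j) (d j) (?\<Omega> j)"
        using assms(7) by (simp add: minimal_projective_resolution_def)
      then have "right_module A (P j)" "is_hom A (P j) (?\<Omega> j) (d j)"
        by (simp_all add: projective_cover_def projective_def is_epi_def)
      then show ?thesis
        unfolding Suc syzygy.simps by (intro rm_submodule ker_submodule[OF A.fd_algebra_axioms _ M])
    qed
  qed
  have dim_s: "mdim (?\<Omega> (i + s)) = mdim (?\<Omega> i)" if "2 * r \<le> i" for i
    by (rule module_iso_mdim[OF A.fd_algebra_axioms rm rm s(2)[OF that]])
  have card_s: "card {y \<in> ?V. (\<psi> ^^ (i + s)) y = a} = card {y \<in> ?V. (\<psi> ^^ i) y = a}" if "r \<le> i" for i
  proof -
    \<comment> \<open>The period \<open>s\<close> may be odd, whereas fibres correspond to even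
      syzygies. It is therefore applied twice, which shifts the exponent of \<psi> by
      \<open>s\<close>.\<close>
    have "mdim (?\<Omega> (2 * i + s + s)) = mdim (?\<Omega> (2 * i))" using dim_s[of "2 * i"] dim_s[of "2 * i + s"] that by simp
    moreover have "2 * i + s + s = 2 * (i + s)" by simp
    ultimately show ?thesis using dim by metis
  qed
  have "(\<Sum>i<p. mdim (?\<Omega> (2 * r + 2 * i))) = (\<Sum>i<p. card {y \<in> ?V. (\<psi> ^^ (r + i)) y = a})"
    using dim[of "r + _"] by (simp add: distrib_left)
  also have "\<dots> = card {y \<in> ?V. \<exists>i. (\<psi> ^^ i) y = a}"
    by (rule sum_card_fibres[OF _ pb(1) pa pa_min s(1) card_s]) simp_all
  also have "\<dots> = card (component (coresolution_arrows n q) a)"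
    unfolding arrows component_arrows[OF \<psi>V assms(5) pb(1) pa] ..
  finally show ?thesis .
qed

end
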